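(* For $R>0$ let $$\Omega_{0,R}=\{\Pi_AF\,;\,F\in L^\infty(\mathbf C^d),\ \operatorname{supp}F\subseteq B_R(0)\},$$ $$\Omega_{1,R}=\{\Pi_AF\,;\,F\in L^\infty(\mathbf C^d),\ \operatorname{supp}F\subseteq D_{d,R}\},$$ $$\Omega_{2,R}=\Big\{F=\sum_{\alpha\in\mathbf N^d}c_\alpha e_\alpha\,;\,\sup_{\alpha\in\mathbf N^d}\big(|c_\alpha|(\alpha!)^{1/2}R^{-|\alpha|}\big)<\infty\Big\},$$ and let $R_0,R\in\mathbf R$ be such that $0<R_0<R$. Then $$\Omega_{0,R}\subseteq\Omega_{2,R}\quad\text{and}\quad\Omega_{2,R_0}\subseteq\Omega_{1,R}.$$ In particular, $$\mathcal S_C(\mathbf R^d)=\mathcal H_{\flat_1}(\mathbf R^d)\quad\text{and}\quad\mathcal H_{0,\flat_1}(\mathbf R^d)\subsetneq\mathcal S_C(\mathbf R^d).$$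
   Context: $e_\alpha(z)=z^\alpha/\sqrt{\alpha!}$, $\alpha\in\mathbf N^d$. $B_R(0)$ is the ball in $\mathbf C^d$ with center $0$ and radius $R$, and $D_{d,R}=\{z\in\mathbf C^d\,;\,|z_j|\le R,\ j=1,\dots,d\}$. Let $d\mu(w)=\pi^{-d}e^{-|w|^2}d\lambda(w)$, with $d\lambda$ Lebesgue measure on $\mathbf C^d$, and $(\Pi_AF)(z)=\int_{\mathbf C^d}F(w)e^{(z,w)}\,d\mu(w)$, where $(z,w)=\sum_jz_j\overline{w_j}$. Let $\phi(x)=\pi^{-d/4}e^{-|x|^2/2}$ on $\mathbf R^d$. $\mathcal S_C(\mathbf R^d)$ (Gröchenig's space) consists of all $f\in L^2(\mathbf R^d)$ of the form $f=V_\phi^*F$ for some $F\in L^\infty(\mathbf R^{2d})$ with compact support, where $V_\phi^*$ is the adjoint of the short-time Fourier transform, i.e. $f(x)=(2\pi)^{-d/2}\iint_{\mathbf R^{2d}}F(y,\eta)\phi(x-y)e^{i\langle x,\eta\rangle}\,dy\,d\eta$. Let $h_\alpha(x)=\pi^{-d/4}(-1)^{|\alpha|}(2^{|\alpha|}\alpha!)^{-1/2}e^{|x|^2/2}\partial^\alpha e^{-|x|^2}$ be the Hermite functions. $\mathcal H_{\flat_1}(\mathbf R^d)$ ($\mathcal H_{0,\flat_1}(\mathbf R^d)$) is the set of all $f=\sum_\alpha c_\alpha h_\alpha$ such that $|c_\alpha|\lesssim r^{|\alpha|}(\alpha!)^{-1/2}$ for some (for every) $r>0$, where $\lesssim$ means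 inequality up to a constant independent of $\alpha$. *)

theory Defs
  imports "HOL-Analysis.Analysis"
begin

text \<open>The dimension \<open>d\<close> is \<open>CARD('n)\<close>; the spaces of dimension \<open>d\<close> over the reals and over the
  complex numbers are \<open>real ^ 'n\<close> and \<open>complex ^ 'n\<close>; multi-indices are functions
  \<open>'n \<Rightarrow> nat\<close>.\<close>

definition mi_abs :: "('n::finite \<Rightarrow> nat) \<Rightarrow> nat" where
  "mi_abs \<alpha> = (\<Sum>i\<in>UNIV. \<alpha> i)"

definition mi_fact :: "('n::finite \<Rightarrow> nat) \<Rightarrow> real" where
  "mi_fact \<alpha> = (\<Prod>i\<in>UNIV. fact (\<alpha> i))"

definition mi_power :: "complex ^ 'n \<Rightarrow> ('n::finite \<Rightarrow> nat) \<Rightarrow> complex" where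
  "mi_power z \<alpha> = (\<Prod>i\<in>UNIV. (z $ i) ^ \<alpha> i)"


subsection \<open>Lebesgue spaces\<close>

text \<open>Elements of \<open>L\<^sup>2\<close> and of \<open>L\<^sup>\<infinity>\<close> are represented by functions, not by classes modulo null
  sets. All sets of such functions below are closed under almost everywhere equality.\<close>

definition L2_space :: "('a::euclidean_space \<Rightarrow> complex) set" where
  "L2_space = {f \<in> borel_measurable lebesgue. integrable lebesgue (\<lambda>x. (cmod (f x))\<^sup>2)}"

definition Linf_space :: "('a::euclidean_space \<Rightarrow> complex) set" where
  "Linf_space = {F \<in> borel_measurable lebesgue. \<exists>C. AE x in lebesgue. cmod (F x) \<le> C}"

text \<open>The support of a class modulo null sets: the complement of the largest open set on which
  \<open>F\<close> vanishes almost everywhere.\<close>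

definition ess_support :: "('a::euclidean_space \<Rightarrow> complex) \<Rightarrow> 'a set" where
  "ess_support F = - \<Union>{U. open U \<and> (AE x in lebesgue. x \<in> U \<longrightarrow> F x = 0)}"

text \<open>Unconditional convergence of \<open>\<Sum>\<^sub>k u\<^sub>k\<close> to \<open>f\<close> in the norm of \<open>L\<^sup>2\<close>.\<close>

definition L2_has_sum :: "('k \<Rightarrow> 'a::euclidean_space \<Rightarrow> complex) \<Rightarrow> ('a \<Rightarrow> complex) \<Rightarrow> bool" where
  "L2_has_sum u f \<longleftrightarrow>
     ((\<lambda>A. \<integral>\<^sup>+ x. ennreal ((cmod (f x - (\<Sum>k\<in>A. u k x)))\<^sup>2) \<partial>lebesgue) \<longlongrightarrow> 0)
       (finite_subsets_at_top UNIV)"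


subsection \<open>Spaces of entire functions\<close>

definition monomial_e :: "('n::finite \<Rightarrow> nat) \<Rightarrow> complex ^ 'n \<Rightarrow> complex" where
  "monomial_e \<alpha> z = mi_power z \<alpha> / complex_of_real (sqrt (mi_fact \<alpha>))"

definition gauss_measure :: "(complex ^ 'n::finite) measure" where
  "gauss_measure =
     density lebesgue (\<lambda>w. ennreal (pi powr (- real CARD('n)) * exp (- (norm w)\<^sup>2)))"

definition Pi_A :: "(complex ^ 'n::finite \<Rightarrow> complex) \<Rightarrow> complex ^ 'n \<Rightarrow> complex" where
  "Pi_A F z = (\<integral>w. F w * exp (\<Sum>j\<in>UNIV. z $ j * cnj (w $ j)) \<partial>gauss_measure)"

definition polydisc :: "real \<Rightarrow> (complex ^ 'n::finite) set" where
  "polydisc R = {z. \<forall>j. cmod (z $ j) \<le> R}"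

text \<open>The ball is taken closed, like the polydisc. As \<open>\<Omega>\<^sub>0\<close> is only bounded from above, the
  statement with the open ball is a special case.\<close>

definition Omega0 :: "real \<Rightarrow> (complex ^ 'n::finite \<Rightarrow> complex) set" where
  "Omega0 R = {Pi_A F | F. F \<in> Linf_space \<and> ess_support F \<subseteq> cball 0 R}"

definition Omega1 :: "real \<Rightarrow> (complex ^ 'n::finite \<Rightarrow> complex) set" where
  "Omega1 R = {Pi_A F | F. F \<in> Linf_space \<and> ess_support F \<subseteq> polydisc R}"

definition Omega2 :: "real \<Rightarrow> (complex ^ 'n::finite \<Rightarrow> complex) set" where
  "Omega2 R = {F. \<exists>c :: ('n \<Rightarrow> nat) \<Rightarrow> complex.
     (\<forall>z. ((\<lambda>\<alpha>. c \<alpha> * monomial_e \<alpha> z) has_sum F z) UNIV) \<and>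
     bdd_above (range (\<lambda>\<alpha>. cmod (c \<alpha>) * sqrt (mi_fact \<alpha>) * R powi (- int (mi_abs \<alpha>))))}"


subsection \<open>The space of Groechenig\<close>

definition gauss_window :: "real ^ 'n::finite \<Rightarrow> real" where
  "gauss_window x = pi powr (- real CARD('n) / 4) * exp (- (norm x)\<^sup>2 / 2)"

definition stft_adjoint ::
    "(real ^ 'n::finite \<Rightarrow> real) \<Rightarrow> ((real ^ 'n) \<times> (real ^ 'n) \<Rightarrow> complex) \<Rightarrow> real ^ 'n \<Rightarrow> complex" where
  "stft_adjoint \<phi> F x = complex_of_real ((2 * pi) powr (- real CARD('n) / 2)) *
     (\<integral>(y, \<eta>). F (y, \<eta>) * complex_of_real (\<phi> (x - y)) * exp (\<i> * complex_of_real (x \<bullet> \<eta>))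
        \<partial>lebesgue)"

definition S_C :: "(real ^ 'n::finite \<Rightarrow> complex) set" where
  "S_C = {f \<in> L2_space. \<exists>F \<in> Linf_space. compact (ess_support F) \<and>
     (AE x in lebesgue. f x = stft_adjoint gauss_window F x)}"


subsection \<open>Hermite functions and the Hermite series spaces\<close>

definition partial_deriv :: "'n \<Rightarrow> (real ^ 'n::finite \<Rightarrow> real) \<Rightarrow> real ^ 'n \<Rightarrow> real" where
  "partial_deriv i f x = deriv (\<lambda>t. f (x + t *\<^sub>R axis i 1)) 0"

text \<open>The derivatives are taken in the order of an unspecified list that contains each index
  \<open>i\<close> exactly \<open>\<alpha> i\<close> times. For smooth \<open>f\<close> the order is immaterial.\<close>

definition mi_deriv :: "('n::finite \<Rightarrow> nat) \<Rightarrow> (real ^ 'n \<Rightarrow> real) \<Rightarrow> real ^ 'n \<Rightarrow> real" where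
  "mi_deriv \<alpha> f = foldr partial_deriv (SOME js. \<forall>i. count_list js i = \<alpha> i) f"

definition hermite_fun :: "('n::finite \<Rightarrow> nat) \<Rightarrow> real ^ 'n \<Rightarrow> real" where
  "hermite_fun \<alpha> x =
     pi powr (- real CARD('n) / 4) * (-1) ^ mi_abs \<alpha> * (2 ^ mi_abs \<alpha> * mi_fact \<alpha>) powr (-1/2) *
     exp ((norm x)\<^sup>2 / 2) * mi_deriv \<alpha> (\<lambda>y. exp (- (norm y)\<^sup>2)) x"

definition hermite_series :: "(('n::finite \<Rightarrow> nat) \<Rightarrow> complex) \<Rightarrow> (real ^ 'n \<Rightarrow> complex) \<Rightarrow> bool" where
  "hermite_series c f \<longleftrightarrow> L2_has_sum (\<lambda>\<alpha> x. c \<alpha> * complex_of_real (hermite_fun \<alpha> x)) f"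

text \<open>In both spaces the condition on the coefficients implies convergence of the Hermite series
  in \<open>L\<^sup>2\<close>, so that formal Hermite series and their \<open>L\<^sup>2\<close> sums need not be distinguished.\<close>

definition H_flat1 :: "(real ^ 'n::finite \<Rightarrow> complex) set" where
  "H_flat1 = {f \<in> L2_space. \<exists>c. hermite_series c f \<and>
     (\<exists>r>0. \<exists>C. \<forall>\<alpha>. cmod (c \<alpha>) \<le> C * (r ^ mi_abs \<alpha> * mi_fact \<alpha> powr (-1/2)))}"

definition H0_flat1 :: "(real ^ 'n::finite \<Rightarrow> complex) set" where
  "H0_flat1 = {f \<in> L2_space. \<exists>c. hermite_series c f \<and>
     (\<forall>r>0. \<exists>C. \<forall>\<alpha>. cmod (c \<alpha>) \<le> C * (r ^ mi_abs \<alpha> * mi_fact \<alpha> powr (-1/2)))}"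

end

theory Submission
  imports Defs "HOL-Complex_Analysis.Cauchy_Integral_Formula" "HOL-Probability.Distributions"
begin

text \<open>
  The spaces of the theorem are described by the growth of moments of bounded functions
  with compact support.

  Expanding \<open>exp (z, w)\<close> shows that \<open>\<Pi>\<^sub>A F\<close> is the power series with coefficients
  \<open>a\<^sub>\<alpha> / \<alpha>!\<close>, where \<open>a\<^sub>\<alpha> = \<integral> F(w) cnj (w\<^sup>\<alpha>) d\<mu>(w)\<close> (lemma \<open>Pi_A_has_sum\<close>). If \<open>F\<close> is
  bounded and lives on the polydisc of radius \<open>R\<close>, then \<open>a\<^sub>\<alpha> = O(R\<^bsup>|\<alpha>|\<^esup>)\<close>; this is the
  first inclusion. Conversely, every sequence \<open>a\<^sub>\<alpha> = O(R\<^sub>0\<^bsup>|\<alpha>|\<^esup>)\<close> with \<open>R\<^sub>0 < R\<close> is such a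
  moment sequence (\<open>bounded_function_with_moments\<close>). The reason is that monomials are orthogonal
  for \<open>\<mu>\<close> restricted to the polydisc, by rotation invariance, and that the mass of \<open>|w\<^sup>\<alpha>|\<^sup>2\<close> there is
  at least a constant times \<open>R\<^sub>1\<^bsup>2|\<alpha>|\<^esup>\<close> for each \<open>R\<^sub>1 < R\<close>: the truncated power series
  whose coefficients are \<open>a\<^sub>\<alpha>\<close> divided by this mass has the moments \<open>a\<^sub>\<alpha>\<close>, and it converges
  uniformly when \<open>R\<^sub>0 R < R\<^sub>1\<^sup>2\<close>. This is the second inclusion.

  On the real side, the generating function of the Hermite functions expands the shifted
  Gaussian \<open>\<phi>(x - y) exp(i x \<bullet> \<eta>)\<close> as
  \<open>exp(- |z|\<^sup>2 / 4 + i y \<bullet> \<eta> / 2) \<Sum>\<^sub>\<alpha> h\<^sub>\<alpha>(x) (z / \<surd>2)\<^sup>\<alpha> / \<surd>\<alpha>!\<close> with \<open>z = y + i \<eta>\<close>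
  (\<open>has_sum_shifted_gaussian\<close>). Hence the coefficients of \<open>V\<^sub>\<phi>\<^sup>* F\<close> with respect to \<open>h\<^sub>\<alpha>\<close> are,
  up to a constant and the factor \<open>2\<^bsup>-|\<alpha>|/2\<^esup> / \<surd>\<alpha>!\<close>, again moments of a bounded function with compact
  support, and the same moment theorem identifies the two spaces.

  The Hermite series are controlled pointwise. A Cauchy estimate for the
  entire function \<open>exp(- z\<^sup>2)\<close> bounds \<open>|h\<^sub>\<alpha>(x)|\<close> by \<open>\<surd>\<alpha>! s\<^bsup>-|\<alpha>|\<^esup>\<close> times a function
  \<open>G\<^sub>s\<close> in \<open>L\<^sup>2\<close>, for every \<open>s > 0\<close> (\<open>hermite_fun_bound\<close>). So a series with coefficients
  \<open>O(r\<^bsup>|\<alpha>|\<^esup> / \<surd>\<alpha>!)\<close> converges pointwise and in \<open>L\<^sup>2\<close> to the same sum, which is \<open>O(G\<^sub>s)\<close>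
  for each \<open>s > r\<close>. This also separates \<open>\<H>\<^sub>0\<close> from \<open>S\<^sub>C\<close>: elements of the former are
  \<open>O(G\<^sub>s)\<close> for all \<open>s > 0\<close>, hence \<open>O(exp(- |x|\<^sup>2 / 2 + \<epsilon> |x|))\<close> for all \<open>\<epsilon> > 0\<close>, and the Gaussian
  with centre \<open>(\<surd>2, ..., \<surd>2)\<close>, whose coefficients are multiples of \<open>1 / \<surd>\<alpha>!\<close>, is not.
\<close>

section \<open>Transformations of Lebesgue measure\<close>

text \<open>A map of this kind only renames coordinates, so it takes boxes to boxes of the same volume.\<close>

lemma distr_lborel_linear_Basis:
  fixes T :: "'a::euclidean_space \<Rightarrow> 'b::euclidean_space"
  assumes "linear T" and bij: "bij_betw T Basis Basis"
  shows "distr lborel borel T = lborel"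
proof (rule lborel_eqI[symmetric])
  interpret T: linear T by fact
  have meas: "T \<in> borel_measurable borel"
    using \<open>linear T\<close> by (intro borel_measurable_continuous_onI linear_continuous_on linear_linear[THEN iffD2])
  have T_Basis: "T b \<in> Basis" if "b \<in> Basis" for b
    using bij that by (auto simp: bij_betw_def)
  have inner_T: "T x \<bullet> T b = x \<bullet> b" if "b \<in> Basis" for x b
  proof -
    have "T x = (\<Sum>a\<in>Basis. (x \<bullet> a) *\<^sub>R T a)"
      by (subst euclidean_representation[of x, symmetric]) (simp add: T.sum T.scale)
    then have "T x \<bullet> T b = (\<Sum>a\<in>Basis. (x \<bullet> a) * (T a \<bullet> T b))"
      by (simp add: inner_sum_left)
    also have "\<dots> = (\<Sum>a\<in>Basis. if a = b then x \<bullet> a else 0)"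
      using bij that T_Basis
      by (intro sum.cong) (auto simp: inner_Basis bij_betw_def inj_on_eq_iff)
    also have "\<dots> = x \<bullet> b"
      using that by simp
    finally show ?thesis .
  qed
  show "sets (distr lborel borel T) = sets borel"
    by simp
  fix l u :: 'b
  assume lu: "\<And>b. b \<in> Basis \<Longrightarrow> l \<bullet> b \<le> u \<bullet> b"
  define l' u' where "l' = (\<Sum>b\<in>Basis. (l \<bullet> T b) *\<^sub>R b)" and "u' = (\<Sum>b\<in>Basis. (u \<bullet> T b) *\<^sub>R b)"
  have l': "l' \<bullet> b = l \<bullet> T b" and u': "u' \<bullet> b = u \<bullet> T b" if "b \<in> Basis" for b
    using that by (simp_all add: l'_def u'_def)
  have Basis_eq: "Basis = T ` Basis"
    using bij by (simp add: bij_betw_def)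
  have "T -` box l u = box l' u'"
    by (auto simp: box_def Basis_eq inner_T l' u' simp flip: Basis_eq)
      (subst (asm) Basis_eq, auto simp: inner_T)+
  then have "emeasure (distr lborel borel T) (box l u) = emeasure lborel (box l' u')"
    using meas by (simp add: emeasure_distr)
  also have "\<dots> = (\<Prod>b\<in>Basis. (u' - l') \<bullet> b)"
    using lu T_Basis by (intro emeasure_lborel_box) (auto simp: l' u')
  also have "(\<Prod>b\<in>Basis. (u' - l') \<bullet> b) = (\<Prod>b\<in>Basis. (u - l) \<bullet> T b)"
    by (intro prod.cong) (auto simp: l' u' inner_diff_left)
  also have "\<dots> = (\<Prod>b\<in>Basis. (u - l) \<bullet> b)"
    by (rule prod.reindex_bij_betw[OF bij])
  finally show "emeasure (distr lborel borel T) (box l u) = (\<Prod>b\<in>Basis. (u - l) \<bullet> b)" .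
qed

lemma distr_lborel_orthogonal:
  fixes f :: "real^'n::{finite,wellorder} \<Rightarrow> real^'n::_"
  assumes f: "orthogonal_transformation f"
  shows "distr lborel borel f = lborel"
proof (rule lborel_eqI[symmetric])
  have "linear f"
    using f by (rule orthogonal_transformation_linear)
  then have meas: "f \<in> borel_measurable borel"
    by (intro borel_measurable_continuous_onI linear_continuous_on linear_linear[THEN iffD2])
  show "sets (distr lborel borel f) = sets borel"
    by simp
  fix l u :: "real^'n::{finite,wellorder}"
  assume lu: "\<And>b. b \<in> Basis \<Longrightarrow> l \<bullet> b \<le> u \<bullet> b"
  have inv: "orthogonal_transformation (inv f)"
    using f by (rule orthogonal_transformation_inv)
  have eq: "f -` box l u = inv f ` box l u"
    using orthogonal_transformation_bij[OF f] by (rule bij_vimage_eq_inv_image)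
  have lm: "box l u \<in> lmeasurable"
    by simp
  have op: "f -` box l u \<in> sets borel"
    using measurable_sets[OF meas, of "box l u"] by simp
  have "f -` box l u \<in> lmeasurable"
    unfolding eq by (rule measurable_orthogonal_image[OF inv lm])
  then have "emeasure lebesgue (f -` box l u) = measure lebesgue (f -` box l u)"
    by (rule emeasure_eq_measure2)
  also have "\<dots> = measure lebesgue (box l u)"
    unfolding eq by (subst measure_orthogonal_image[OF inv lm]) simp
  also have "\<dots> = emeasure lebesgue (box l u)"
    using emeasure_eq_measure2[OF lm] by simp
  finally have "emeasure lborel (f -` box l u) = emeasure lborel (box l u)"
    using op by (simp add: emeasure_completion)
  then show "emeasure (distr lborel borel f) (box l u) = (\<Prod>b\<in>Basis. (u - l) \<bullet> b)"
    using meas lu by (simp add: emeasure_distr emeasure_lborel_box)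
qed

text \<open>Transported to \<open>\<real>\<^sup>2\<close>, multiplication by a unimodular number is an orthogonal
  transformation. This invariance is what makes monomials orthogonal on discs.\<close>

lemma distr_lborel_complex_rotation:
  assumes c: "cmod c = 1"
  shows "distr lborel borel (\<lambda>z. c * z) = lborel"
proof -
  define \<phi> :: "real^2 \<Rightarrow> complex" where "\<phi> v = Complex (v$1) (v$2)" for v
  define f :: "real^2 \<Rightarrow> real^2"
    where "f v = vector [Re c * v$1 - Im c * v$2, Im c * v$1 + Re c * v$2]" for v
  have \<phi>: "linear \<phi>"
    by (rule linearI) (auto simp: \<phi>_def complex_eq_iff)
  have "bij_betw \<phi> Basis Basis"
    unfolding bij_betw_def
  proof
    have B: "(Basis :: (real^2) set) = {axis 1 1, axis 2 1}"
      by (auto simp: Basis_vec_def UNIV_2)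
    have v: "\<phi> (axis 1 1) = 1" "\<phi> (axis 2 1) = \<i>"
      by (auto simp: \<phi>_def axis_def complex_eq_iff)
    show "inj_on \<phi> Basis" "\<phi> ` Basis = Basis"
      by (auto simp: B v Basis_complex_def inj_on_def complex_eq_iff)
  qed
  with \<phi> have D\<phi>: "distr lborel borel \<phi> = lborel"
    by (rule distr_lborel_linear_Basis)
  have "linear f"
    by (rule linearI) (auto simp: f_def vec_eq_iff forall_2 algebra_simps)
  have "(Re c)\<^sup>2 + (Im c)\<^sup>2 = 1"
    using c by (metis cmod_power2 one_power2)
  then have "norm (f v) = norm v" for v
  proof -
    have "(norm (f v))\<^sup>2 = ((Re c)\<^sup>2 + (Im c)\<^sup>2) * (norm v)\<^sup>2"
      unfolding power2_norm_eq_inner by (simp add: f_def inner_vec_def sum_2 power2_eq_square algebra_simps)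
    then show ?thesis
      using \<open>(Re c)\<^sup>2 + (Im c)\<^sup>2 = 1\<close> by simp
  qed
  then have f: "orthogonal_transformation f"
    using \<open>linear f\<close> by (simp add: orthogonal_transformation)
  have meas: "\<phi> \<in> borel_measurable borel" "f \<in> borel_measurable borel" "(\<lambda>z. c * z) \<in> borel_measurable borel"
    using \<phi> \<open>linear f\<close>
    by (auto intro!: borel_measurable_continuous_onI linear_continuous_on linear_linear[THEN iffD2] continuous_intros)
  have comp: "(\<lambda>z. c * z) \<circ> \<phi> = \<phi> \<circ> f"
    by (auto simp: fun_eq_iff \<phi>_def f_def complex_eq_iff)
  have "distr lborel borel (\<lambda>z. c * z) = distr (distr lborel borel \<phi>) borel (\<lambda>z. c * z)"
    by (simp add: D\<phi>)
  also have "\<dots> = distr lborel borel (\<phi> \<circ> f)"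
    using meas by (subst distr_distr) (auto simp: comp)
  also have "\<dots> = distr (distr lborel borel f) borel \<phi>"
    using meas by (subst distr_distr) auto
  also have "\<dots> = lborel"
    by (simp add: distr_lborel_orthogonal[OF f] D\<phi>)
  finally show ?thesis .
qed

lemma vec_lambda_measurable:
  "vec_lambda \<in> measurable (Pi\<^sub>M UNIV (\<lambda>_. lborel)) (borel :: ('a::euclidean_space ^ 'n::finite) measure)"
proof -
  have *: "(vec_lambda :: ('n \<Rightarrow> 'a) \<Rightarrow> _) = (\<lambda>f. \<Sum>i\<in>UNIV. axis i (f i))"
    by (auto simp: fun_eq_iff vec_eq_iff axis_def sum.delta)
  have "linear (axis i :: 'a \<Rightarrow> 'a ^ 'n)" for i
    by (rule linearI) (auto simp: axis_def vec_eq_iff)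
  then have "(axis i :: 'a \<Rightarrow> 'a ^ 'n) \<in> borel_measurable lborel" for i
    by (auto intro!: borel_measurable_continuous_onI linear_continuous_on linear_linear[THEN iffD2])
  then show ?thesis
    unfolding * by (intro borel_measurable_sum measurable_compose[OF measurable_component_singleton]) auto
qed

text \<open>Fubini in vector form: integrals of products over \<open>\<complex>\<^sup>d\<close> factor into integrals
  over the coordinates.\<close>

lemma distr_PiM_lborel_vec:
  "distr (Pi\<^sub>M UNIV (\<lambda>_. lborel)) borel vec_lambda = (lborel :: ('a::euclidean_space ^ 'n::finite) measure)"
proof (rule lborel_eqI[symmetric])
  interpret product_sigma_finite "\<lambda>_::'n. lborel :: 'a measure"
    by standard
  show "sets (distr (Pi\<^sub>M UNIV (\<lambda>_. lborel)) borel vec_lambda :: ('a^'n) measure) = sets borel"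
    by simp
  fix l u :: "'a^'n"
  assume lu: "\<And>b. b \<in> Basis \<Longrightarrow> l \<bullet> b \<le> u \<bullet> b"
  have lu': "l $ i \<bullet> b \<le> u $ i \<bullet> b" if "b \<in> Basis" for i b
    using lu[of "axis i b"] that by (auto simp: Basis_vec_def inner_axis)
  have "(vec_lambda -` box l u :: ('n \<Rightarrow> 'a) set) = (\<Pi>\<^sub>E i\<in>UNIV. box (l$i) (u$i))"
    by (fastforce simp: box_def Basis_vec_def inner_axis PiE_iff)
  then have "emeasure (distr (Pi\<^sub>M UNIV (\<lambda>_. lborel)) borel vec_lambda) (box l u)
      = emeasure (Pi\<^sub>M UNIV (\<lambda>_. lborel)) (\<Pi>\<^sub>E i\<in>UNIV. box (l$i) (u$i))"
    by (simp add: emeasure_distr vec_lambda_measurable space_PiM)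
  also have "\<dots> = (\<Prod>i\<in>UNIV. emeasure lborel (box (l$i) (u$i)))"
    by (rule emeasure_PiM) auto
  also have "\<dots> = (\<Prod>i\<in>UNIV. ennreal (\<Prod>b\<in>Basis. (u$i - l$i) \<bullet> b))"
    using lu' by (simp add: emeasure_lborel_box)
  also have "\<dots> = ennreal (\<Prod>i\<in>UNIV. \<Prod>b\<in>Basis. (u$i - l$i) \<bullet> b)"
    using lu' by (intro prod_ennreal) (auto intro!: prod_nonneg simp: inner_diff_left)
  also have "(\<Prod>i\<in>UNIV. \<Prod>b\<in>Basis. (u$i - l$i) \<bullet> b) = (\<Prod>(i,b)\<in>UNIV\<times>Basis. (u - l) \<bullet> axis i b)"
    by (simp add: prod.cartesian_product inner_axis)
  also have "\<dots> = (\<Prod>b\<in>Basis. (u - l) \<bullet> b)"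
  proof -
    have bij: "bij_betw (\<lambda>(i::'n, b::'a). axis i b) (UNIV \<times> Basis) Basis"
      by (auto simp: bij_betw_def inj_on_def Basis_vec_def axis_eq_axis nonzero_Basis)
    show ?thesis
      using prod.reindex_bij_betw[OF bij, of "\<lambda>b. (u - l) \<bullet> b"] by (simp add: case_prod_unfold)
  qed
  finally show "emeasure (distr (Pi\<^sub>M UNIV (\<lambda>_. lborel)) borel vec_lambda) (box l u)
      = ennreal (\<Prod>b\<in>Basis. (u - l) \<bullet> b)" .
qed

lemma lborel_integral_vec_prod:
  fixes f :: "'n::finite \<Rightarrow> 'a::euclidean_space \<Rightarrow> complex"
  assumes "\<And>i. integrable lborel (f i)"
  shows "integrable lborel (\<lambda>x :: 'a^'n. \<Prod>i\<in>UNIV. f i (x $ i))"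
    and "(LINT x|(lborel :: ('a^'n) measure). (\<Prod>i\<in>UNIV. f i (x $ i))) = (\<Prod>i\<in>UNIV. \<integral>y. f i y \<partial>lborel)"
proof -
  interpret product_sigma_finite "\<lambda>_::'n. lborel :: 'a measure"
    by standard
  have meas: "(\<lambda>x :: 'a^'n. \<Prod>i\<in>UNIV. f i (x $ i)) \<in> borel_measurable borel"
  proof (intro borel_measurable_prod)
    fix i :: 'n
    have "(\<lambda>x :: 'a^'n. x $ i) \<in> borel_measurable borel"
      by (intro borel_measurable_continuous_onI continuous_intros)
    moreover have "f i \<in> borel_measurable borel"
      using borel_measurable_integrable[OF assms] by simp
    ultimately show "(\<lambda>x :: 'a^'n. f i (x $ i)) \<in> borel_measurable borel"
      by (rule measurable_compose)
  qed
  show "integrable lborel (\<lambda>x :: 'a^'n. \<Prod>i\<in>UNIV. f i (x $ i))"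
    by (subst distr_PiM_lborel_vec[symmetric], subst integrable_distr_eq[OF vec_lambda_measurable meas])
      (use product_integrable_prod[OF finite assms] in simp)
  show "(LINT x|(lborel :: ('a^'n) measure). (\<Prod>i\<in>UNIV. f i (x $ i))) = (\<Prod>i\<in>UNIV. \<integral>y. f i y \<partial>lborel)"
    by (subst distr_PiM_lborel_vec[symmetric], subst integral_distr[OF vec_lambda_measurable meas])
      (use product_integral_prod[OF finite assms] in simp)
qed

section \<open>Sums over multi-indices\<close>

text \<open>Unordered sums over a countable index set reduce to series along an enumeration, for which
  dominated convergence is available. The index set is infinite so that it can be enumerated by a
  bijection with \<open>\<nat>\<close>.\<close>

lemma has_sum_integral:
  fixes f :: "'k::countable \<Rightarrow> 'a \<Rightarrow> 'b::{banach,second_countable_topology}"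
  assumes inf: "infinite (UNIV :: 'k set)"
    and f: "\<And>k. integrable M (f k)"
    and int: "(\<lambda>k. \<integral>x. norm (f k x) \<partial>M) summable_on UNIV"
    and abs: "\<And>x. (\<lambda>k. norm (f k x)) summable_on UNIV"
    and sum: "\<And>x. ((\<lambda>k. f k x) has_sum g x) UNIV"
  shows "((\<lambda>k. \<integral>x. f k x \<partial>M) has_sum (\<integral>x. g x \<partial>M)) UNIV"
proof -
  define e :: "nat \<Rightarrow> 'k" where "e = from_nat_into UNIV"
  have e: "bij_betw e UNIV UNIV"
    unfolding e_def using bij_betw_from_nat_into[OF _ inf] by simp
  have s1: "summable (\<lambda>n. \<integral>x. norm (f (e n) x) \<partial>M)"
    using int by (subst (asm) summable_on_reindex_bij_betw[OF e, symmetric]) (rule summable_on_imp_summable)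
  have s2: "summable (\<lambda>n. norm (f (e n) x))" for x
    using abs[of x] by (subst (asm) summable_on_reindex_bij_betw[OF e, symmetric]) (rule summable_on_imp_summable)
  have g: "(\<Sum>n. f (e n) x) = g x" for x
    using sum[of x] by (subst (asm) has_sum_reindex_bij_betw[OF e, symmetric])
      (metis has_sum_imp_sums sums_unique)
  have "(\<lambda>n. \<integral>x. f (e n) x \<partial>M) sums (\<integral>x. (\<Sum>n. f (e n) x) \<partial>M)"
    using f s1 s2 by (intro sums_integral) auto
  moreover have "summable (\<lambda>n. norm (\<integral>x. f (e n) x \<partial>M))"
    by (rule summable_comparison_test'[OF s1, of 0]) simp
  ultimately have "((\<lambda>n. \<integral>x. f (e n) x \<partial>M) has_sum (\<integral>x. g x \<partial>M)) UNIV"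
    unfolding g by (intro norm_summable_imp_has_sum)
  then show ?thesis
    by (subst has_sum_reindex_bij_betw[OF e, symmetric])
qed

lemma infinite_UNIV_multiindex: "infinite (UNIV :: ('n::finite \<Rightarrow> nat) set)"
proof
  assume "finite (UNIV :: ('n \<Rightarrow> nat) set)"
  moreover have "inj (\<lambda>k::nat. (\<lambda>_. k) :: 'n \<Rightarrow> nat)"
    by (auto simp: inj_def fun_eq_iff)
  ultimately show False
    using finite_subset[OF subset_UNIV] range_inj_infinite by metis
qed

lemma has_sum_prod_multiindex:
  fixes f :: "'n::finite \<Rightarrow> nat \<Rightarrow> 'c::{banach, real_normed_field, second_countable_topology}"
  assumes abs: "\<And>i. (\<lambda>k. norm (f i k)) summable_on UNIV"
    and sum: "\<And>i. (f i has_sum s i) UNIV"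
  shows "((\<lambda>\<alpha>. \<Prod>i\<in>UNIV. f i (\<alpha> i)) has_sum (\<Prod>i\<in>UNIV. s i)) UNIV"
    and "(\<lambda>\<alpha>. norm (\<Prod>i\<in>UNIV. f i (\<alpha> i))) summable_on UNIV"
proof -
  have U: "(UNIV :: ('n \<Rightarrow> nat) set) = PiE UNIV (\<lambda>_. UNIV)"
    by (auto simp: PiE_UNIV_domain)
  show *: "(\<lambda>\<alpha>. norm (\<Prod>i\<in>UNIV. f i (\<alpha> i))) summable_on UNIV"
    unfolding U abs_summable_equivalent
    by (rule abs_summable_on_prod_PiE) (use abs in \<open>auto simp: abs_summable_equivalent\<close>)
  have "infsum (\<lambda>\<alpha>. \<Prod>i\<in>UNIV. f i (\<alpha> i)) UNIV = (\<Prod>i\<in>UNIV. infsum (f i) UNIV)"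
    unfolding U by (rule infsum_prod_PiE_abs) (use abs in auto)
  also have "\<dots> = (\<Prod>i\<in>UNIV. s i)"
    using infsumI[OF sum] by simp
  finally show "((\<lambda>\<alpha>. \<Prod>i\<in>UNIV. f i (\<alpha> i)) has_sum (\<Prod>i\<in>UNIV. s i)) UNIV"
    using abs_summable_summable[OF *] by (metis has_sum_infsum)
qed

section \<open>Gaussian integrals and essential supports\<close>

text \<open>Completing the square in each coordinate reduces the claim to the normal density.\<close>

lemma nn_integral_gaussian_bound_finite:
  fixes c :: real
  assumes "c \<ge> 0"
  shows "(\<integral>\<^sup>+x. ennreal (\<Prod>b\<in>Basis. exp (- (x \<bullet> b)\<^sup>2 + c * \<bar>x \<bullet> b\<bar>)) \<partial>(lborel :: 'a::euclidean_space measure)) < \<infinity>"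
proof -
  have 1: "(\<integral>\<^sup>+x. ennreal (exp (- x\<^sup>2 + c * \<bar>x\<bar>)) \<partial>(lborel :: real measure)) < \<infinity>"
  proof -
    have "(\<integral>\<^sup>+x. ennreal (exp (- x\<^sup>2 + c * \<bar>x\<bar>)) \<partial>(lborel :: real measure))
        \<le> (\<integral>\<^sup>+x. ennreal (exp (c\<^sup>2 / 2) * sqrt (2 * pi) * std_normal_density x) \<partial>lborel)"
    proof (intro nn_integral_mono ennreal_leI)
      fix x :: real
      have "- x\<^sup>2 + c * \<bar>x\<bar> \<le> c\<^sup>2 / 2 - x\<^sup>2 / 2"
        using zero_le_power2[of "c - \<bar>x\<bar>"] by (simp add: power2_diff)
      then show "exp (- x\<^sup>2 + c * \<bar>x\<bar>) \<le> exp (c\<^sup>2 / 2) * sqrt (2 * pi) * std_normal_density x"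
        by (simp add: std_normal_density_def flip: exp_add)
    qed
    also have "\<dots> < \<infinity>"
      by (subst nn_integral_eq_integral) (auto intro!: integrable_mult_right)
    finally show ?thesis .
  qed
  have "(\<integral>\<^sup>+x. ennreal (\<Prod>b\<in>Basis. exp (- (x \<bullet> b)\<^sup>2 + c * \<bar>x \<bullet> b\<bar>)) \<partial>(lborel :: 'a measure))
      = (\<integral>\<^sup>+x. (\<Prod>b\<in>Basis. ennreal (exp (- (x \<bullet> b)\<^sup>2 + c * \<bar>x \<bullet> b\<bar>))) \<partial>(lborel :: 'a measure))"
    by (simp add: prod_ennreal)
  also have "\<dots> = (\<Prod>b\<in>(Basis::'a set). \<integral>\<^sup>+x. ennreal (exp (- x\<^sup>2 + c * \<bar>x\<bar>)) \<partial>lborel)"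
    by (rule nn_integral_lborel_prod) auto
  also have "\<dots> < \<infinity>"
    using 1 by (simp add: power_less_top_ennreal)
  finally show ?thesis .
qed

text \<open>The complement of the essential support is a union of possibly uncountably many open sets on which
  \<open>F\<close> vanishes almost everywhere; by the Lindeloef property countably many of them suffice.\<close>

lemma AE_notin_ess_support:
  fixes F :: "'a::euclidean_space \<Rightarrow> complex"
  shows "AE x in lebesgue. x \<notin> ess_support F \<longrightarrow> F x = 0"
proof -
  define \<U> where "\<U> = {U. open U \<and> (AE x in lebesgue. x \<in> U \<longrightarrow> F x = 0)}"
  obtain \<V> where \<V>: "\<V> \<subseteq> \<U>" "countable \<V>" "\<Union>\<V> = \<Union>\<U>"
    using Lindelof[of \<U>] by (auto simp: \<U>_def)
  have "AE x in lebesgue. \<forall>U\<in>\<V>. x \<in> U \<longrightarrow> F x = 0"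
    using \<V> by (subst AE_ball_countable) (auto simp: \<U>_def)
  then show ?thesis
  proof eventually_elim
    case (elim x)
    then show ?case
      using \<V>(3) unfolding ess_support_def \<U>_def[symmetric] by blast
  qed
qed

lemma ess_support_subset:
  fixes F :: "'a::euclidean_space \<Rightarrow> complex"
  assumes "closed K" "\<And>x. x \<notin> K \<Longrightarrow> F x = 0"
  shows "ess_support F \<subseteq> K"
proof -
  have "- K \<in> {U. open U \<and> (AE x in lebesgue. x \<in> U \<longrightarrow> F x = 0)}"
    using assms by (auto simp: open_Compl)
  then show ?thesis
    unfolding ess_support_def by blast
qed

lemma closed_ess_support: "closed (ess_support F)"
  unfolding ess_support_def by (auto simp: closed_def)

section \<open>Monomials and elementary multi-index series\<close>

lemma mi_fact_pos: "mi_fact \<alpha> > 0"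
  by (simp add: mi_fact_def prod_pos)

lemma abs_mi_fact [simp]: "\<bar>mi_fact \<alpha>\<bar> = mi_fact \<alpha>"
  using mi_fact_pos[of \<alpha>] by simp

lemma prod_power_mi_abs: "(\<Prod>i\<in>UNIV. r ^ \<alpha> i) = (r :: 'a::comm_monoid_mult) ^ mi_abs \<alpha>"
  for \<alpha> :: "'n::finite \<Rightarrow> nat"
  by (simp add: mi_abs_def power_sum)

lemma norm_mi_power_le:
  assumes "w \<in> polydisc R"
  shows "cmod (mi_power w \<alpha>) \<le> R ^ mi_abs \<alpha>"
  unfolding mi_power_def prod_power_mi_abs[symmetric] prod_norm[symmetric]
  using assms by (intro prod_mono) (auto simp: polydisc_def norm_power power_mono)

lemma mi_power_measurable [measurable]: "(\<lambda>w. mi_power w \<alpha>) \<in> borel_measurable borel"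
  unfolding mi_power_def by (intro borel_measurable_continuous_onI continuous_intros)

lemma summable_geometric_multiindex:
  assumes "0 \<le> q" "q < (1::real)"
  shows "(\<lambda>\<alpha> :: 'n::finite \<Rightarrow> nat. q ^ mi_abs \<alpha>) summable_on UNIV"
proof -
  have eq: "norm (q ^ k) = q ^ k" for k
    using assms by simp
  have s: "summable (\<lambda>k. q ^ k)"
    using assms by (intro summable_geometric) simp
  have "(\<lambda>k. norm (q ^ k)) summable_on UNIV"
    using s by (intro norm_summable_imp_summable_on) (use assms in \<open>simp add: power_abs\<close>)
  moreover have "((\<lambda>k. q ^ k) has_sum (\<Sum>k. q ^ k)) UNIV"
    using s by (intro norm_summable_imp_has_sum) (use assms in \<open>simp_all add: power_abs summable_sums\<close>)
  ultimately have "(\<lambda>\<alpha> :: 'n \<Rightarrow> nat. norm (\<Prod>i\<in>UNIV. q ^ \<alpha> i)) summable_on UNIV"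
    by (intro has_sum_prod_multiindex(2)) auto
  then show ?thesis
    using assms by (simp add: prod_power_mi_abs)
qed

lemma has_sum_exp_multiindex:
  fixes u :: "'n::finite \<Rightarrow> complex"
  shows "((\<lambda>\<alpha>. (\<Prod>i\<in>UNIV. u i ^ \<alpha> i) / mi_fact \<alpha>) has_sum exp (\<Sum>i\<in>UNIV. u i)) UNIV"
    and "(\<lambda>\<alpha>. (\<Prod>i\<in>UNIV. cmod (u i) ^ \<alpha> i) / mi_fact \<alpha>) summable_on UNIV"
proof -
  have abs: "(\<lambda>k. norm (u i ^ k / fact k)) summable_on UNIV" for i
    using summable_norm_exp[of "u i"]
    by (intro norm_summable_imp_summable_on) (simp add: scaleR_conv_of_real divide_inverse norm_mult mult.commute)
  have sum: "((\<lambda>k. u i ^ k / fact k) has_sum exp (u i)) UNIV" for i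
    using summable_norm_exp[of "u i"] exp_converges[of "u i"]
    by (intro norm_summable_imp_has_sum) (simp_all add: scaleR_conv_of_real divide_inverse norm_mult mult.commute)
  have eq: "(\<Prod>i\<in>UNIV. u i ^ \<alpha> i / fact (\<alpha> i)) = (\<Prod>i\<in>UNIV. u i ^ \<alpha> i) / mi_fact \<alpha>" for \<alpha>
    by (simp add: mi_fact_def prod_dividef)
  have "((\<lambda>\<alpha>. \<Prod>i\<in>UNIV. u i ^ \<alpha> i / fact (\<alpha> i)) has_sum (\<Prod>i\<in>UNIV. exp (u i))) UNIV"
    using abs sum by (rule has_sum_prod_multiindex)
  then show "((\<lambda>\<alpha>. (\<Prod>i\<in>UNIV. u i ^ \<alpha> i) / mi_fact \<alpha>) has_sum exp (\<Sum>i\<in>UNIV. u i)) UNIV"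
    by (simp only: eq exp_sum finite)
  have "(\<lambda>\<alpha>. norm (\<Prod>i\<in>UNIV. u i ^ \<alpha> i / fact (\<alpha> i))) summable_on UNIV"
    using abs sum by (rule has_sum_prod_multiindex)
  then show "(\<lambda>\<alpha>. (\<Prod>i\<in>UNIV. cmod (u i) ^ \<alpha> i) / mi_fact \<alpha>) summable_on UNIV"
    unfolding eq norm_divide using mi_fact_pos by (simp add: norm_power abs_of_pos flip: prod_norm)
qed

lemma has_sum_measurable:
  fixes f :: "'k::countable \<Rightarrow> 'a \<Rightarrow> complex"
  assumes inf: "infinite (UNIV :: 'k set)"
    and f: "\<And>k. f k \<in> borel_measurable M"
    and sum: "\<And>x. ((\<lambda>k. f k x) has_sum g x) UNIV"
  shows "g \<in> borel_measurable M"
proof -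
  define e :: "nat \<Rightarrow> 'k" where "e = from_nat_into UNIV"
  have e: "bij_betw e UNIV UNIV"
    unfolding e_def using bij_betw_from_nat_into[OF _ inf] by simp
  have "(\<Sum>n. f (e n) x) = g x" for x
    using sum[of x] by (subst (asm) has_sum_reindex_bij_betw[OF e, symmetric])
      (metis has_sum_imp_sums sums_unique)
  moreover have "(\<lambda>x. \<Sum>n. f (e n) x) \<in> borel_measurable M"
    by (intro borel_measurable_suminf f)
  ultimately show ?thesis
    by simp
qed

lemma norm_power2_Basis: "(norm x)\<^sup>2 = (\<Sum>b\<in>Basis. (x \<bullet> b)\<^sup>2)" for x :: "'a::euclidean_space"
  unfolding power2_norm_eq_inner by (subst euclidean_inner) (simp add: power2_eq_square)

lemma norm_power2_vec: "(norm x)\<^sup>2 = (\<Sum>i\<in>UNIV. (norm (x $ i))\<^sup>2)" for x :: "'a::real_inner ^ 'n::finite"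
  unfolding norm_vec_def L2_set_def by (simp add: sum_nonneg)

section \<open>The Gaussian measure on \<open>\<complex>\<^sup>d\<close>\<close>

definition gauss_density :: "complex ^ 'n::finite \<Rightarrow> real" where
  "gauss_density w = pi powr (- real CARD('n)) * exp (- (norm w)\<^sup>2)"

lemma gauss_density_measurable [measurable]: "gauss_density \<in> borel_measurable borel"
  unfolding gauss_density_def by measurable

lemma gauss_measure_eq: "gauss_measure = density lebesgue (\<lambda>w. ennreal (gauss_density w))"
  by (simp add: gauss_measure_def gauss_density_def)

lemma gauss_density_nonneg: "0 \<le> gauss_density w"
  by (simp add: gauss_density_def)

lemma sets_gauss_measure [measurable_cong, simp]: "sets gauss_measure = sets lebesgue"
  by (simp add: gauss_measure_def)

lemma space_gauss_measure [simp]: "space gauss_measure = UNIV"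
  by (simp add: gauss_measure_def)

lemma borel_measurable_lebesgueI: "f \<in> borel_measurable borel \<Longrightarrow> f \<in> borel_measurable lebesgue"
  by (simp add: measurable_completion)

lemma measurable_gauss_cong [simp]: "borel_measurable gauss_measure = borel_measurable lebesgue"
  by (rule measurable_cong_sets) auto

lemma AE_gauss_measureI: "AE w in lebesgue. P w \<Longrightarrow> AE w in gauss_measure. P w"
  unfolding gauss_measure_eq
  by (subst AE_density) (auto intro!: borel_measurable_lebesgueI)

lemma integral_gauss_measure:
  fixes f :: "complex ^ 'n::finite \<Rightarrow> complex"
  assumes "f \<in> borel_measurable borel"
  shows "(\<integral>w. f w \<partial>gauss_measure) = (\<integral>w. gauss_density w * f w \<partial>lborel)"
proof -
  have "(\<integral>w. f w \<partial>gauss_measure) = (\<integral>w. gauss_density w *\<^sub>R f w \<partial>lebesgue)"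
    unfolding gauss_measure_eq using assms
    by (intro integral_density) (auto intro!: borel_measurable_lebesgueI simp: gauss_density_nonneg)
  also have "\<dots> = (\<integral>w. gauss_density w *\<^sub>R f w \<partial>lborel)"
    using assms by (intro integral_completion) auto
  finally show ?thesis
    by (simp add: scaleR_conv_of_real)
qed

lemma finite_measure_gauss: "finite_measure (gauss_measure :: (complex ^ 'n::finite) measure)"
proof
  have "emeasure (gauss_measure :: (complex ^ 'n) measure) UNIV = (\<integral>\<^sup>+w. ennreal (gauss_density w) \<partial>(lborel :: (complex ^ 'n) measure))"
    unfolding gauss_measure_eq
    by (subst emeasure_density) (auto intro!: borel_measurable_lebesgueI simp: nn_integral_completion)
  also have "\<dots> = (\<integral>\<^sup>+w. ennreal (pi powr (- real CARD('n))) *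
      ennreal (\<Prod>b\<in>Basis. exp (- (w \<bullet> b)\<^sup>2 + 0 * \<bar>w \<bullet> b\<bar>)) \<partial>(lborel :: (complex ^ 'n) measure))"
    by (simp add: gauss_density_def norm_power2_Basis exp_sum ennreal_mult' flip: sum_negf)
  also have "\<dots> < \<infinity>"
    using nn_integral_gaussian_bound_finite[of 0, where 'a = "complex ^ 'n"]
    by (subst nn_integral_cmult) (auto simp: ennreal_mult_less_top)
  finally show "emeasure (gauss_measure :: (complex ^ 'n) measure) (space gauss_measure) \<noteq> \<infinity>"
    by simp
qed

section \<open>Power series of the projections \<open>\<Pi>\<^sub>A F\<close>\<close>

text \<open>Integrate the exponential series of the reproducing kernel term by term. On the polydisc the
  term with index \<open>\<alpha>\<close> is dominated by \<open>(\<Prod>\<^sub>i (R |z\<^sub>i|)\<^bsup>\<alpha>\<^sub>i\<^esup>) / \<alpha>!\<close>, which is summable.\<close>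

lemma Pi_A_has_sum:
  fixes F :: "complex ^ 'n::finite \<Rightarrow> complex"
  defines "a \<equiv> \<lambda>\<alpha>. \<integral>w. F w * cnj (mi_power w \<alpha>) \<partial>gauss_measure"
  assumes F: "F \<in> Linf_space" and supp: "AE w in lebesgue. w \<notin> polydisc R \<longrightarrow> F w = 0" and "R > 0"
  shows "\<exists>C. \<forall>\<alpha>. cmod (a \<alpha>) \<le> C * R ^ mi_abs \<alpha>"
    and "((\<lambda>\<alpha>. a \<alpha> / mi_fact \<alpha> * mi_power z \<alpha>) has_sum Pi_A F z) UNIV"
proof -
  interpret finite_measure "gauss_measure :: (complex ^ 'n) measure"
    by (rule finite_measure_gauss)
  obtain C0 where C0: "AE w in lebesgue. cmod (F w) \<le> C0" and F_meas: "F \<in> borel_measurable lebesgue"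
    using F by (auto simp: Linf_space_def)
  define C where "C = max C0 0"
  have "C \<ge> 0"
    by (simp add: C_def)
  have bound: "AE w in gauss_measure. cmod (F w * cnj (mi_power w \<alpha>)) \<le> C * R ^ mi_abs \<alpha>" for \<alpha>
    using AE_gauss_measureI[OF C0] AE_gauss_measureI[OF supp]
  proof eventually_elim
    case (elim w)
    then show ?case
      using norm_mi_power_le[of w R \<alpha>] \<open>C \<ge> 0\<close> \<open>R > 0\<close>
      by (cases "w \<in> polydisc R") (auto simp: norm_mult C_def intro!: mult_mono)
  qed
  have meas: "(\<lambda>w. F w * cnj (mi_power w \<alpha>)) \<in> borel_measurable gauss_measure" for \<alpha>
    using F_meas borel_measurable_lebesgueI[OF mi_power_measurable[of \<alpha>]]
    by (auto intro!: borel_measurable_times measurable_compose[of _ lebesgue borel cnj]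
        borel_measurable_continuous_onI continuous_intros)
  have int: "integrable gauss_measure (\<lambda>w. F w * cnj (mi_power w \<alpha>))" for \<alpha>
    by (rule integrable_const_bound[OF bound meas])
  define m where "m = measure (gauss_measure :: (complex ^ 'n) measure) UNIV"
  have norm_int: "(\<integral>w. cmod (F w * cnj (mi_power w \<alpha>)) \<partial>gauss_measure) \<le> C * R ^ mi_abs \<alpha> * m" for \<alpha>
    using integral_mono_AE[OF integrable_norm[OF int] integrable_const bound, of \<alpha>]
    by (simp add: m_def mult_ac)
  have a: "cmod (a \<alpha>) \<le> (C * m) * R ^ mi_abs \<alpha>" for \<alpha>
    unfolding a_def using order_trans[OF integral_norm_bound norm_int] by (simp add: mult_ac)
  then show "\<exists>C. \<forall>\<alpha>. cmod (a \<alpha>) \<le> C * R ^ mi_abs \<alpha>"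
    by blast
  define f where "f \<alpha> w = F w * cnj (mi_power w \<alpha>) * (mi_power z \<alpha> / mi_fact \<alpha>)" for \<alpha> w
  have f_eq: "f \<alpha> w = F w * ((\<Prod>i\<in>UNIV. (z $ i * cnj (w $ i)) ^ \<alpha> i) / mi_fact \<alpha>)" for \<alpha> w
    by (simp add: f_def mi_power_def power_mult_distrib prod.distrib)
  have f_int: "(\<integral>w. f \<alpha> w \<partial>gauss_measure) = a \<alpha> / mi_fact \<alpha> * mi_power z \<alpha>" for \<alpha>
    unfolding f_def a_def by (simp add: int)
  have "((\<lambda>\<alpha>. \<integral>w. f \<alpha> w \<partial>gauss_measure) has_sum
      (\<integral>w. F w * exp (\<Sum>j\<in>UNIV. z $ j * cnj (w $ j)) \<partial>gauss_measure)) UNIV"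
  proof (rule has_sum_integral[OF infinite_UNIV_multiindex])
    show "integrable gauss_measure (f \<alpha>)" for \<alpha>
      unfolding f_def using int by (intro integrable_mult_left)
    show "((\<lambda>\<alpha>. f \<alpha> w) has_sum F w * exp (\<Sum>j\<in>UNIV. z $ j * cnj (w $ j))) UNIV" for w
      unfolding f_eq by (intro has_sum_cmult_right has_sum_exp_multiindex)
    show "(\<lambda>\<alpha>. norm (f \<alpha> w)) summable_on UNIV" for w
      using summable_on_cmult_right[OF has_sum_exp_multiindex(2)[of "\<lambda>i. z $ i * cnj (w $ i)"], of "cmod (F w)"] mi_fact_pos
      by (simp add: f_eq norm_mult norm_divide norm_power abs_of_pos flip: prod_norm)
    have "(\<lambda>\<alpha>. (C * m) * ((\<Prod>i\<in>UNIV. cmod (R * z $ i) ^ \<alpha> i) / mi_fact \<alpha>)) summable_on UNIV"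
      by (intro summable_on_cmult_right has_sum_exp_multiindex)
    then show "(\<lambda>\<alpha>. \<integral>w. norm (f \<alpha> w) \<partial>gauss_measure) summable_on UNIV"
    proof (rule summable_on_comparison_test)
      fix \<alpha> :: "'n \<Rightarrow> nat"
      have "(\<integral>w. norm (f \<alpha> w) \<partial>gauss_measure)
          = (\<integral>w. cmod (F w * cnj (mi_power w \<alpha>)) \<partial>gauss_measure) * (cmod (mi_power z \<alpha>) / mi_fact \<alpha>)"
        using mi_fact_pos[of \<alpha>] by (simp add: f_def norm_mult norm_divide abs_of_pos)
      also have "\<dots> \<le> C * R ^ mi_abs \<alpha> * m * (cmod (mi_power z \<alpha>) / mi_fact \<alpha>)"
        using norm_int mi_fact_pos[of \<alpha>] by (intro mult_right_mono) auto
      also have "\<dots> = (C * m) * ((\<Prod>i\<in>UNIV. cmod (R * z $ i) ^ \<alpha> i) / mi_fact \<alpha>)"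
        using \<open>R > 0\<close>
        by (simp add: mi_power_def norm_mult norm_power power_mult_distrib prod.distrib prod_power_mi_abs flip: prod_norm)
      finally show "(\<integral>w. norm (f \<alpha> w) \<partial>gauss_measure)
          \<le> (C * m) * ((\<Prod>i\<in>UNIV. cmod (R * z $ i) ^ \<alpha> i) / mi_fact \<alpha>)" .
    qed simp
  qed
  then show "((\<lambda>\<alpha>. a \<alpha> / mi_fact \<alpha> * mi_power z \<alpha>) has_sum Pi_A F z) UNIV"
    by (simp add: f_int Pi_A_def)
qed

section \<open>Moments of bounded functions on a polydisc\<close>

text \<open>The integrand of one coordinate of the inner product of two monomials, for the Gaussian measure
  restricted to a polydisc.\<close>

definition disc_moment :: "real \<Rightarrow> nat \<Rightarrow> nat \<Rightarrow> complex \<Rightarrow> complex" where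
  "disc_moment R k m z = indicator (cball 0 R) z * (exp (- (cmod z)\<^sup>2) / pi) * (z ^ k * cnj z ^ m)"

lemma disc_moment_integrable: "integrable lborel (disc_moment R k m)"
proof -
  have "integrable lborel (\<lambda>z. indicat_real (cball 0 R) z *\<^sub>R
      (complex_of_real (exp (- (cmod z)\<^sup>2) / pi) * (z ^ k * cnj z ^ m)))"
    by (intro borel_integrable_compact continuous_intros) auto
  then show ?thesis
    by (rule Bochner_Integration.integrable_cong[THEN iffD1, rotated -1])
      (auto simp: disc_moment_def fun_eq_iff indicator_def)
qed

lemma disc_moment_measurable [measurable]: "disc_moment R k m \<in> borel_measurable borel"
  using borel_measurable_integrable[OF disc_moment_integrable[of R k m]] by simp

text \<open>A rotation by the angle \<open>\<pi> / (k - m)\<close> turns the integral into its negative.\<close>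

lemma integral_disc_moment_neq:
  assumes "k \<noteq> m"
  shows "integral\<^sup>L lborel (disc_moment R k m) = 0"
proof -
  define c where "c = cis (pi / (real k - real m))"
  have c: "cmod c = 1"
    by (simp add: c_def)
  have rot: "disc_moment R k m (c * z) = c ^ k * cnj c ^ m * disc_moment R k m z" for z
    using c by (simp add: disc_moment_def indicator_def norm_mult power_mult_distrib)
  have "c ^ k * cnj c ^ m = cis (real k * (pi / (real k - real m)) + real m * - (pi / (real k - real m)))"
    unfolding c_def cis_cnj Complex.DeMoivre cis_mult ..
  also have "real k * (pi / (real k - real m)) + real m * - (pi / (real k - real m)) =
      (real k - real m) * (pi / (real k - real m))"
    by (simp add: left_diff_distrib diff_divide_distrib)
  also have "\<dots> = pi"
    using assms by simp
  finally have c': "c ^ k * cnj c ^ m = - 1"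
    by simp
  have "integral\<^sup>L lborel (disc_moment R k m) = integral\<^sup>L (distr lborel borel (\<lambda>z. c * z)) (disc_moment R k m)"
    by (simp add: distr_lborel_complex_rotation[OF c])
  also have "\<dots> = (\<integral>z. disc_moment R k m (c * z) \<partial>lborel)"
    by (rule integral_distr) auto
  also have "\<dots> = - integral\<^sup>L lborel (disc_moment R k m)"
    by (simp add: rot c')
  finally show ?thesis
    by simp
qed

text \<open>The lower bound for the mass of \<open>|z|\<^bsup>2k\<^esup>\<close> comes from a small disc inside
  the annulus between the radii \<open>R1\<close> and \<open>R\<close>, where the integrand is at least
  \<open>exp (- R\<^sup>2) / \<pi>\<close> times \<open>R1\<^bsup>2k\<^esup>\<close>.\<close>

lemma integral_disc_moment_eq:
  assumes "0 < R1" "R1 < R"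
  obtains M \<kappa> where "\<kappa> > 0" "\<And>k. integral\<^sup>L lborel (disc_moment R k k) = complex_of_real (M k)"
    "\<And>k. M k \<ge> \<kappa> * R1 ^ (2 * k)"
proof
  define A :: "complex set" where "A = ball (of_real ((R1 + R) / 2)) ((R - R1) / 2)"
  define \<kappa> where "\<kappa> = exp (- R\<^sup>2) / pi * measure lborel A"
  define M where "M k = (\<integral>z. indicator (cball 0 R) z * (exp (- (cmod z)\<^sup>2) / pi) * cmod z ^ (2 * k) \<partial>lborel)" for k
  have A: "R1 < cmod z \<and> cmod z < R" if "z \<in> A" for z
  proof -
    have d: "cmod (of_real ((R1 + R) / 2) - z) < (R - R1) / 2"
      using that by (simp add: A_def dist_norm)
    have n: "cmod (of_real ((R1 + R) / 2)) = (R1 + R) / 2"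
      using assms by (simp only: norm_of_real) simp
    show ?thesis
      using d norm_triangle_ineq2[of "of_real ((R1 + R) / 2)" z] norm_triangle_ineq2[of z "of_real ((R1 + R) / 2)"]
      unfolding n norm_minus_commute[of z] by (auto simp: field_simps)
  qed
  show "\<kappa> > 0"
    using assms content_ball_pos[of "(R - R1) / 2" "of_real ((R1 + R) / 2) :: complex"]
    by (simp add: \<kappa>_def A_def)
  have eq: "disc_moment R k k z = of_real (indicator (cball 0 R) z * (exp (- (cmod z)\<^sup>2) / pi) * cmod z ^ (2 * k))" for k z
  proof -
    have "z ^ k * cnj z ^ k = of_real (cmod z ^ (2 * k))"
      by (metis complex_norm_square of_real_power power_mult power_mult_distrib)
    then show ?thesis
      by (simp add: disc_moment_def)
  qed
  show "integral\<^sup>L lborel (disc_moment R k k) = complex_of_real (M k)" for k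
    unfolding M_def integral_complex_of_real[symmetric] by (intro Bochner_Integration.integral_cong refl eq)
  show "M k \<ge> \<kappa> * R1 ^ (2 * k)" for k
  proof -
    have "integrable lborel (\<lambda>z. Re (disc_moment R k k z))"
      using disc_moment_integrable by (rule integrable_Re)
    then have i: "integrable lborel (\<lambda>z. indicator (cball 0 R) z * (exp (- (cmod z)\<^sup>2) / pi) * cmod z ^ (2 * k))"
      by (simp only: eq Re_complex_of_real)
    have "\<kappa> * R1 ^ (2 * k) = (\<integral>z. indicator A z * (exp (- R\<^sup>2) / pi * R1 ^ (2 * k)) \<partial>lborel)"
      by (simp add: \<kappa>_def A_def)
    also have "\<dots> \<le> M k"
      unfolding M_def
    proof (rule integral_mono[OF _ i])
      show "integrable lborel (\<lambda>z. indicator A z * (exp (- R\<^sup>2) / pi * R1 ^ (2 * k)))"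
        unfolding A_def using emeasure_bounded_finite[OF bounded_ball] by (intro integrable_mult_left integrable_real_indicator) auto
      show "indicator A z * (exp (- R\<^sup>2) / pi * R1 ^ (2 * k))
          \<le> indicator (cball 0 R) z * (exp (- (cmod z)\<^sup>2) / pi) * cmod z ^ (2 * k)" for z
        using A[of z] assms
        by (auto simp: indicator_def intro!: mult_mono divide_right_mono power_mono)
    qed
    finally show ?thesis .
  qed
qed

lemma polydisc_integral:
  fixes \<alpha> \<beta> :: "'n::finite \<Rightarrow> nat"
  shows "(\<integral>w. gauss_density w * (indicator (polydisc R) w * mi_power w \<beta> * cnj (mi_power w \<alpha>)) \<partial>lborel)
      = (\<Prod>i\<in>UNIV. integral\<^sup>L lborel (disc_moment R (\<beta> i) (\<alpha> i)))" (is ?eq)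
    and "integrable lborel (\<lambda>w. gauss_density w * (indicator (polydisc R) w * mi_power w \<beta> * cnj (mi_power w \<alpha>)))" (is ?int)
proof -
  have ind: "indicator (polydisc R) w = (\<Prod>i\<in>UNIV. indicator (cball 0 R) (w $ i) :: complex)" for w :: "complex ^ 'n"
    by (auto simp: indicator_def polydisc_def)
  have dens: "complex_of_real (gauss_density w) = (\<Prod>i\<in>UNIV. exp (- (cmod (w $ i))\<^sup>2) / pi)" for w :: "complex ^ 'n"
    by (simp add: gauss_density_def norm_power2_vec exp_sum powr_minus powr_realpow divide_inverse prod.distrib mult.commute
        power_inverse flip: sum_negf of_real_prod)
  have eq: "gauss_density w * (indicator (polydisc R) w * mi_power w \<beta> * cnj (mi_power w \<alpha>))
      = (\<Prod>i\<in>UNIV. disc_moment R (\<beta> i) (\<alpha> i) (w $ i))" for w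
    unfolding ind dens of_real_prod disc_moment_def mi_power_def prod.distrib[symmetric] cnj_prod
    by (rule prod.cong) (auto simp: indicator_def)
  show ?eq ?int
    unfolding eq by (rule lborel_integral_vec_prod disc_moment_integrable)+
qed

lemma closed_polydisc: "closed (polydisc R)"
proof -
  have "polydisc R = (\<Inter>j. {z. cmod (z $ j) \<le> R})"
    by (auto simp: polydisc_def)
  also have "closed \<dots>"
    by (intro closed_INT ballI closed_Collect_le continuous_intros)
  finally show ?thesis .
qed

text \<open>The function is the power series with coefficients \<open>a\<^sub>\<beta> / m\<^sub>\<beta>\<close>, cut off outside the
  polydisc, where \<open>m\<^sub>\<beta>\<close> is the mass of \<open>|w\<^sup>\<beta>|\<^sup>2\<close> on the polydisc. Orthogonality of monomials gives
  the moments. On the polydisc the terms are at most a constant times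
  \<open>(R0 R / R1\<^sup>2)\<^bsup>|\<beta>|\<^esup>\<close>, so the series is bounded once \<open>R1\<^sup>2\<close> lies strictly between \<open>R0 R\<close> and
  \<open>R\<^sup>2\<close>.\<close>

theorem bounded_function_with_moments:
  fixes a :: "('n::finite \<Rightarrow> nat) \<Rightarrow> complex"
  assumes a: "\<And>\<alpha>. cmod (a \<alpha>) \<le> C * R0 ^ mi_abs \<alpha>" and R: "0 < R0" "R0 < R"
  obtains G :: "complex ^ 'n \<Rightarrow> complex" and B where
    "G \<in> borel_measurable borel" "\<And>w. cmod (G w) \<le> B" "\<And>w. w \<notin> polydisc R \<Longrightarrow> G w = 0"
    "\<And>\<alpha>. (\<integral>w. gauss_density w * (G w * cnj (mi_power w \<alpha>)) \<partial>lborel) = a \<alpha>"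
proof -
  \<comment> \<open>\<open>R1\<^sup>2\<close> is the mean of \<open>R R0\<close> and \<open>R\<^sup>2\<close>.\<close>
  define R1 where "R1 = sqrt (R * ((R0 + R) / 2))"
  have R1_sq: "R1\<^sup>2 = R * ((R0 + R) / 2)"
    unfolding R1_def using R by (intro real_sqrt_pow2) auto
  have "R1 > 0"
    unfolding R1_def using R by (intro real_sqrt_gt_zero mult_pos_pos) auto
  have "R1\<^sup>2 < R\<^sup>2"
    unfolding R1_sq power2_eq_square[of R] using R by (intro mult_strict_left_mono) auto
  then have "R1 < R"
    using R by (intro power_less_imp_less_base[of R1 2 R]) auto
  obtain \<kappa> M where \<kappa>: "\<kappa> > 0" and M: "\<And>k. integral\<^sup>L lborel (disc_moment R k k) = complex_of_real (M k)"
    and M_ge: "\<And>k. M k \<ge> \<kappa> * R1 ^ (2 * k)"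
    by (rule integral_disc_moment_eq[OF \<open>R1 > 0\<close> \<open>R1 < R\<close>]) (rule that)
  have M_pos: "M k > 0" for k
    by (rule less_le_trans[OF _ M_ge]) (use \<kappa> \<open>R1 > 0\<close> in simp)
  define m :: "('n \<Rightarrow> nat) \<Rightarrow> real" where "m \<alpha> = (\<Prod>i\<in>UNIV. M (\<alpha> i))" for \<alpha>
  have m_ge: "m \<alpha> \<ge> \<kappa> ^ CARD('n) * (R1\<^sup>2) ^ mi_abs \<alpha>" for \<alpha>
  proof -
    have "\<kappa> ^ CARD('n) * (R1\<^sup>2) ^ mi_abs \<alpha> = (\<Prod>i\<in>UNIV. \<kappa> * R1 ^ (2 * \<alpha> i))"
      by (simp add: prod.distrib power_mult flip: prod_power_mi_abs)
    also have "\<dots> \<le> m \<alpha>"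
      unfolding m_def using \<kappa> M_ge \<open>R1 > 0\<close> by (intro prod_mono) auto
    finally show ?thesis .
  qed
  have m_pos: "m \<alpha> > 0" for \<alpha>
    using M_pos by (simp add: m_def prod_pos)
  define q where "q = R0 * R / R1\<^sup>2"
  have "R * R0 < R1\<^sup>2"
    unfolding R1_sq using R by (intro mult_strict_left_mono) auto
  then have q: "0 \<le> q" "q < 1"
    using R \<open>R1 > 0\<close> by (simp_all add: q_def mult.commute)
  define b where "b \<alpha> = a \<alpha> / m \<alpha>" for \<alpha>
  have "C \<ge> 0"
    using order_trans[OF norm_ge_zero a[of "\<lambda>_. 0"]] by (simp add: mi_abs_def)
  define g where "g \<beta> w = indicator (polydisc R) w * (b \<beta> * mi_power w \<beta>)" for \<beta> and w :: "complex ^ 'n"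
  have g_bound: "cmod (g \<beta> w) \<le> C / \<kappa> ^ CARD('n) * q ^ mi_abs \<beta>" for \<beta> w
  proof (cases "w \<in> polydisc R")
    case True
    have "cmod (g \<beta> w) \<le> cmod (a \<beta>) / m \<beta> * R ^ mi_abs \<beta>"
      using True norm_mi_power_le[OF True, of \<beta>] m_pos[of \<beta>]
      by (auto simp: g_def b_def norm_mult norm_divide intro!: mult_left_mono divide_right_mono)
    also have "\<dots> \<le> C * R0 ^ mi_abs \<beta> / (\<kappa> ^ CARD('n) * (R1\<^sup>2) ^ mi_abs \<beta>) * R ^ mi_abs \<beta>"
      using a[of \<beta>] m_ge[of \<beta>] m_pos[of \<beta>] \<kappa> \<open>R1 > 0\<close> R \<open>C \<ge> 0\<close>
      by (intro mult_right_mono frac_le) auto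
    also have "\<dots> = C / \<kappa> ^ CARD('n) * q ^ mi_abs \<beta>"
      by (simp add: q_def power_divide power_mult_distrib)
    finally show ?thesis .
  qed (use \<open>C \<ge> 0\<close> \<kappa> q in \<open>auto simp: g_def\<close>)
  have maj: "(\<lambda>\<beta> :: 'n \<Rightarrow> nat. C / \<kappa> ^ CARD('n) * q ^ mi_abs \<beta>) summable_on UNIV"
    by (intro summable_on_cmult_right summable_geometric_multiindex q)
  have g_abs: "(\<lambda>\<beta>. cmod (g \<beta> w)) summable_on UNIV" for w
    using maj by (rule Infinite_Sum.abs_summable_on_comparison_test') (rule g_bound)
  define G where "G w = infsum (\<lambda>\<beta>. g \<beta> w) UNIV" for w
  have G: "((\<lambda>\<beta>. g \<beta> w) has_sum G w) UNIV" for w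
    unfolding G_def by (rule has_sum_infsum[OF Infinite_Sum.abs_summable_summable[OF g_abs]])
  have [measurable]: "polydisc R \<in> sets (borel :: (complex ^ 'n) measure)"
    using closed_polydisc by (rule borel_closed)
  have g_meas: "g \<beta> \<in> borel_measurable borel" for \<beta>
    unfolding g_def by measurable
  have G_meas: "G \<in> borel_measurable borel"
    using g_meas G by (rule has_sum_measurable[OF infinite_UNIV_multiindex])
  have G_bound: "cmod (G w) \<le> infsum (\<lambda>\<beta>. C / \<kappa> ^ CARD('n) * q ^ mi_abs \<beta>) (UNIV :: ('n \<Rightarrow> nat) set)" for w
    unfolding G_def using norm_infsum_bound[OF g_abs[of w]] infsum_mono[OF g_abs maj g_bound] by (rule order_trans)
  have G_out: "G w = 0" if "w \<notin> polydisc R" for w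
    using that by (simp add: G_def g_def)
  have moments: "(\<integral>w. gauss_density w * (G w * cnj (mi_power w \<alpha>)) \<partial>lborel) = a \<alpha>" for \<alpha>
  proof -
    define f where "f \<beta> w = gauss_density w * (g \<beta> w * cnj (mi_power w \<alpha>))" for \<beta> and w :: "complex ^ 'n"
    have f_eq: "f \<beta> w = b \<beta> * (gauss_density w * (indicator (polydisc R) w * mi_power w \<beta> * cnj (mi_power w \<alpha>)))" for \<beta> w
      by (simp add: f_def g_def)
    have f_int: "(\<integral>w. f \<beta> w \<partial>lborel) = (if \<beta> = \<alpha> then a \<alpha> else 0)" for \<beta>
    proof (cases "\<beta> = \<alpha>")
      case True
      then have "(\<integral>w. f \<beta> w \<partial>lborel) = b \<alpha> * complex_of_real (m \<alpha>)"
        by (simp add: f_eq polydisc_integral M m_def)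
      with True show ?thesis
        using m_pos[of \<alpha>] by (simp add: b_def)
    next
      case False
      then obtain i where "\<beta> i \<noteq> \<alpha> i"
        by auto
      then have "(\<Prod>i\<in>UNIV. integral\<^sup>L lborel (disc_moment R (\<beta> i) (\<alpha> i))) = 0"
        by (auto simp: prod_zero_iff intro!: integral_disc_moment_neq)
      with False show ?thesis
        by (simp add: f_eq polydisc_integral)
    qed
    have "((\<lambda>\<beta>. \<integral>w. f \<beta> w \<partial>lborel) has_sum (\<integral>w. gauss_density w * (G w * cnj (mi_power w \<alpha>)) \<partial>lborel)) UNIV"
    proof (rule has_sum_integral[OF infinite_UNIV_multiindex])
      show f_intble: "integrable lborel (f \<beta>)" for \<beta>
        unfolding f_eq by (intro integrable_mult_right polydisc_integral)
      show "((\<lambda>\<beta>. f \<beta> w) has_sum gauss_density w * (G w * cnj (mi_power w \<alpha>))) UNIV" for w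
        unfolding f_def by (intro has_sum_cmult_right has_sum_cmult_left G)
      show "(\<lambda>\<beta>. norm (f \<beta> w)) summable_on UNIV" for w
        unfolding f_def norm_mult by (intro summable_on_cmult_right summable_on_cmult_left g_abs)
      define h where "h w = cmod (gauss_density w * (indicator (polydisc R) w * mi_power w (\<lambda>_. 0) * cnj (mi_power w \<alpha>)))" for w :: "complex ^ 'n"
      have h: "integrable lborel h"
        unfolding h_def by (intro integrable_norm polydisc_integral)
      have "(\<lambda>\<beta> :: 'n \<Rightarrow> nat. C / \<kappa> ^ CARD('n) * q ^ mi_abs \<beta> * (\<integral>w. h w \<partial>lborel)) summable_on UNIV"
        by (intro summable_on_cmult_left maj)
      then show "(\<lambda>\<beta>. \<integral>w. norm (f \<beta> w) \<partial>lborel) summable_on UNIV"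
      proof (rule summable_on_comparison_test)
        fix \<beta> :: "'n \<Rightarrow> nat"
        have "norm (f \<beta> w) \<le> C / \<kappa> ^ CARD('n) * q ^ mi_abs \<beta> * h w" for w
        proof -
          have "norm (f \<beta> w) = cmod (g \<beta> w) * h w"
            by (auto simp: f_def g_def h_def norm_mult mi_power_def indicator_def)
          also have "\<dots> \<le> C / \<kappa> ^ CARD('n) * q ^ mi_abs \<beta> * h w"
            by (intro mult_right_mono g_bound) (simp add: h_def)
          finally show ?thesis .
        qed
        then have "(\<integral>w. norm (f \<beta> w) \<partial>lborel) \<le> (\<integral>w. C / \<kappa> ^ CARD('n) * q ^ mi_abs \<beta> * h w \<partial>lborel)"
          by (intro integral_mono integrable_norm f_intble integrable_mult_right h)
        then show "(\<integral>w. norm (f \<beta> w) \<partial>lborel) \<le> C / \<kappa> ^ CARD('n) * q ^ mi_abs \<beta> * (\<integral>w. h w \<partial>lborel)"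
          by simp
      qed simp
    qed
    moreover have "((\<lambda>\<beta>. \<integral>w. f \<beta> w \<partial>lborel) has_sum a \<alpha>) UNIV"
      by (rule has_sum_finite_neutralI[of "{\<alpha>}"]) (auto simp: f_int)
    ultimately show ?thesis
      by (rule has_sum_unique)
  qed
  show thesis
    by (rule that[OF G_meas G_bound G_out moments])
qed

section \<open>The inclusions between spaces of entire functions\<close>

lemma cball_subset_polydisc: "cball 0 R \<subseteq> polydisc R"
  by (auto simp: polydisc_def intro: order_trans[OF Finite_Cartesian_Product.norm_nth_le])

lemma Omega0_subset_Omega2:
  assumes "R > 0"
  shows "(Omega0 R :: (complex ^ 'n::finite \<Rightarrow> complex) set) \<subseteq> Omega2 R"
proof
  fix H :: "complex ^ 'n \<Rightarrow> complex"
  assume "H \<in> Omega0 R"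
  then obtain F where H: "H = Pi_A F" and F: "F \<in> Linf_space" and supp: "ess_support F \<subseteq> cball 0 R"
    by (auto simp: Omega0_def)
  have out: "AE w in lebesgue. w \<notin> polydisc R \<longrightarrow> F w = 0"
    using AE_notin_ess_support[of F]
    by eventually_elim (use supp cball_subset_polydisc in blast)
  define a where "a \<alpha> = (\<integral>w. F w * cnj (mi_power w \<alpha>) \<partial>gauss_measure)" for \<alpha>
  obtain C where C: "\<And>\<alpha>. cmod (a \<alpha>) \<le> C * R ^ mi_abs \<alpha>"
    using Pi_A_has_sum(1)[OF F out assms] by (auto simp: a_def)
  have sum: "((\<lambda>\<alpha>. a \<alpha> / mi_fact \<alpha> * mi_power z \<alpha>) has_sum H z) UNIV" for z
    unfolding H a_def by (rule Pi_A_has_sum(2)[OF F out assms])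
  define c where "c \<alpha> = a \<alpha> / sqrt (mi_fact \<alpha>)" for \<alpha>
  have "c \<alpha> * monomial_e \<alpha> z = a \<alpha> / mi_fact \<alpha> * mi_power z \<alpha>" for \<alpha> z
    using mi_fact_pos[of \<alpha>] by (simp add: c_def monomial_e_def flip: of_real_mult)
  with sum have "((\<lambda>\<alpha>. c \<alpha> * monomial_e \<alpha> z) has_sum H z) UNIV" for z
    by simp
  moreover have "bdd_above (range (\<lambda>\<alpha>. cmod (c \<alpha>) * sqrt (mi_fact \<alpha>) * R powi (- int (mi_abs \<alpha>))))"
  proof (rule bdd_aboveI2)
    fix \<alpha> :: "'n \<Rightarrow> nat"
    have "cmod (c \<alpha>) * sqrt (mi_fact \<alpha>) * R powi (- int (mi_abs \<alpha>)) = cmod (a \<alpha>) / R ^ mi_abs \<alpha>"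
      using mi_fact_pos[of \<alpha>] by (simp add: c_def norm_divide power_int_minus field_simps)
    also have "\<dots> \<le> C"
      using C[of \<alpha>] \<open>R > 0\<close> by (simp add: divide_le_eq)
    finally show "cmod (c \<alpha>) * sqrt (mi_fact \<alpha>) * R powi (- int (mi_abs \<alpha>)) \<le> C" .
  qed
  ultimately show "H \<in> Omega2 R"
    unfolding Omega2_def by blast
qed

lemma Omega2_subset_Omega1:
  assumes R: "0 < R0" "R0 < R"
  shows "(Omega2 R0 :: (complex ^ 'n::finite \<Rightarrow> complex) set) \<subseteq> Omega1 R"
proof
  fix H :: "complex ^ 'n \<Rightarrow> complex"
  assume "H \<in> Omega2 R0"
  then obtain c where sum: "\<And>z. ((\<lambda>\<alpha>. c \<alpha> * monomial_e \<alpha> z) has_sum H z) UNIV"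
    and "bdd_above (range (\<lambda>\<alpha>. cmod (c \<alpha>) * sqrt (mi_fact \<alpha>) * R0 powi (- int (mi_abs \<alpha>))))"
    unfolding Omega2_def by blast
  then obtain C where C: "\<And>\<alpha>. cmod (c \<alpha>) * sqrt (mi_fact \<alpha>) * R0 powi (- int (mi_abs \<alpha>)) \<le> C"
    by (auto simp: bdd_above_def)
  define a where "a \<alpha> = c \<alpha> * sqrt (mi_fact \<alpha>)" for \<alpha>
  have a: "cmod (a \<alpha>) \<le> C * R0 ^ mi_abs \<alpha>" for \<alpha>
    using C[of \<alpha>] R mi_fact_pos[of \<alpha>]
    by (simp add: a_def norm_mult power_int_minus field_simps)
  obtain G :: "complex ^ 'n \<Rightarrow> complex" and B where G: "G \<in> borel_measurable borel" "\<And>w. cmod (G w) \<le> B"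
    and out: "\<And>w. w \<notin> polydisc R \<Longrightarrow> G w = 0"
    and moments: "\<And>\<alpha>. (\<integral>w. gauss_density w * (G w * cnj (mi_power w \<alpha>)) \<partial>lborel) = a \<alpha>"
    using bounded_function_with_moments[of a, OF a R] by blast
  have [measurable]: "G \<in> borel_measurable borel" "cnj \<in> borel_measurable borel"
    by (fact G) (intro borel_measurable_continuous_onI continuous_intros)
  have Linf: "G \<in> Linf_space"
    using G by (auto simp: Linf_space_def intro!: borel_measurable_lebesgueI exI[of _ B])
  have a_eq: "(\<integral>w. G w * cnj (mi_power w \<alpha>) \<partial>gauss_measure) = a \<alpha>" for \<alpha>
    by (subst integral_gauss_measure) (auto simp: moments)
  have "((\<lambda>\<alpha>. a \<alpha> / mi_fact \<alpha> * mi_power z \<alpha>) has_sum Pi_A G z) UNIV" for z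
    using Pi_A_has_sum(2)[OF Linf, of R z] out R by (simp add: a_eq)
  moreover have "a \<alpha> / mi_fact \<alpha> * mi_power z \<alpha> = c \<alpha> * monomial_e \<alpha> z" for \<alpha> z
  proof -
    have "complex_of_real (sqrt (mi_fact \<alpha>)) * sqrt (mi_fact \<alpha>) = mi_fact \<alpha>"
      using mi_fact_pos[of \<alpha>] by (simp flip: of_real_mult)
    with mi_fact_pos[of \<alpha>] show ?thesis
      unfolding a_def monomial_e_def by (simp add: divide_simps)
  qed
  ultimately have "H = Pi_A G"
    using sum by (intro ext) (metis (no_types, lifting) has_sum_cong has_sum_unique)
  moreover have "ess_support G \<subseteq> polydisc R"
    using closed_polydisc out by (rule ess_support_subset)
  ultimately show "H \<in> Omega1 R"
    using Linf unfolding Omega1_def by blast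
qed

section \<open>Hermite functions of one variable\<close>

abbreviation gauss_entire :: "complex \<Rightarrow> complex" where
  "gauss_entire \<equiv> \<lambda>z. exp (- z\<^sup>2)"

text \<open>The \<open>k\<close>-th derivative of \<open>exp (- t\<^sup>2)\<close>, obtained from its entire extension so that Taylor
  expansion and Cauchy estimates apply to it.\<close>

definition gauss_deriv :: "nat \<Rightarrow> real \<Rightarrow> real" where
  "gauss_deriv k t = Re ((deriv ^^ k) gauss_entire (of_real t))"

lemma gauss_entire_holomorphic: "(deriv ^^ k) gauss_entire holomorphic_on S"
proof -
  have "(deriv ^^ k) gauss_entire holomorphic_on UNIV"
    by (intro holomorphic_higher_deriv holomorphic_intros) auto
  then show ?thesis
    by (rule holomorphic_on_subset) auto
qed

lemma gauss_entire_deriv_along_reals: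
  shows "((\<lambda>t. Re ((deriv ^^ k) gauss_entire (of_real t))) has_real_derivative
      Re ((deriv ^^ Suc k) gauss_entire (of_real t))) (at t)"
    and "((\<lambda>t. Im ((deriv ^^ k) gauss_entire (of_real t))) has_real_derivative
      Im ((deriv ^^ Suc k) gauss_entire (of_real t))) (at t)"
proof -
  have "((deriv ^^ k) gauss_entire has_field_derivative (deriv ^^ Suc k) gauss_entire (of_real t)) (at (of_real t))"
    by (rule has_field_derivative_higher_deriv[of _ UNIV]) (auto intro!: holomorphic_intros)
  then have v: "((\<lambda>t. (deriv ^^ k) gauss_entire (of_real t)) has_vector_derivative
      (deriv ^^ Suc k) gauss_entire (of_real t)) (at t)"
    by (rule has_vector_derivative_real_field)
  from bounded_linear.has_vector_derivative[OF bounded_linear_Re v]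
    bounded_linear.has_vector_derivative[OF bounded_linear_Im v]
  show "((\<lambda>t. Re ((deriv ^^ k) gauss_entire (of_real t))) has_real_derivative
      Re ((deriv ^^ Suc k) gauss_entire (of_real t))) (at t)"
    "((\<lambda>t. Im ((deriv ^^ k) gauss_entire (of_real t))) has_real_derivative
      Im ((deriv ^^ Suc k) gauss_entire (of_real t))) (at t)"
    by (simp_all add: has_real_derivative_iff_has_vector_derivative)
qed

text \<open>The higher derivatives are real on the real axis, since the imaginary part stays
  constantly zero there under differentiation.\<close>

lemma gauss_deriv_of_real: "complex_of_real (gauss_deriv k t) = (deriv ^^ k) gauss_entire (of_real t)"
proof -
  have "Im ((deriv ^^ k) gauss_entire (of_real t)) = 0" for t
  proof (induction k arbitrary: t)
    case 0
    then show ?case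
      by (simp flip: of_real_power of_real_minus add: exp_of_real)
  next
    case (Suc k)
    have "(\<lambda>t. Im ((deriv ^^ k) gauss_entire (of_real t))) = (\<lambda>t. 0)"
      using Suc by auto
    with gauss_entire_deriv_along_reals(2)[of k t]
    have "((\<lambda>t. 0) has_real_derivative Im ((deriv ^^ Suc k) gauss_entire (of_real t))) (at t)"
      by simp
    then show ?case
      using DERIV_unique DERIV_const by blast
  qed
  then show ?thesis
    by (simp add: gauss_deriv_def complex_eq_iff)
qed

lemma gauss_deriv_0: "gauss_deriv 0 t = exp (- t\<^sup>2)"
  by (simp add: gauss_deriv_def Re_exp)

lemma has_real_derivative_gauss_deriv:
  "(gauss_deriv k has_real_derivative gauss_deriv (Suc k) t) (at t)"
  using gauss_entire_deriv_along_reals(1)[of k t] unfolding gauss_deriv_def[abs_def] .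

lemma gauss_deriv_sums: "(\<lambda>k. complex_of_real (gauss_deriv k t) / fact k * v ^ k) sums exp (- (of_real t + v)\<^sup>2)"
  using holomorphic_power_series[of gauss_entire "of_real t" "cmod v + 1" "of_real t + v"]
    gauss_entire_holomorphic[of 0]
  by (simp add: gauss_deriv_of_real dist_norm)

text \<open>The Cauchy estimate on the circle of radius \<open>\<sigma>\<close> around \<open>t\<close>.\<close>

lemma gauss_deriv_bound:
  assumes "\<sigma> > 0"
  shows "\<bar>gauss_deriv k t\<bar> \<le> fact k / \<sigma> ^ k * exp (- t\<^sup>2 + 2 * \<bar>t\<bar> * \<sigma> + \<sigma>\<^sup>2)"
proof -
  have "cmod ((deriv ^^ k) gauss_entire (of_real t)) \<le> fact k * exp (- t\<^sup>2 + 2 * \<bar>t\<bar> * \<sigma> + \<sigma>\<^sup>2) / \<sigma> ^ k"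
  proof (rule Cauchy_inequality)
    show "gauss_entire holomorphic_on ball (of_real t) \<sigma>"
      using gauss_entire_holomorphic[of 0] by simp
    show "continuous_on (cball (of_real t) \<sigma>) gauss_entire"
      by (intro continuous_intros)
    fix x
    assume x: "cmod (of_real t - x) = \<sigma>"
    define v where "v = x - of_real t"
    have v: "cmod v = \<sigma>" "x = of_real t + v"
      using x by (simp_all add: v_def norm_minus_commute)
    have b1: "Re (- x\<^sup>2) = - t\<^sup>2 - 2 * t * Re v - Re (v\<^sup>2)"
      by (simp add: v(2) power2_eq_square algebra_simps)
    have b2: "- 2 * t * Re v \<le> 2 * \<bar>t\<bar> * \<sigma>"
    proof -
      have "- (t * Re v) \<le> \<bar>t\<bar> * \<bar>Re v\<bar>"
        by (metis abs_ge_minus_self abs_mult)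
      also have "\<dots> \<le> \<bar>t\<bar> * \<sigma>"
        using abs_Re_le_cmod[of v] v by (intro mult_left_mono) auto
      finally show ?thesis
        by (simp add: algebra_simps)
    qed
    have b3: "- Re (v\<^sup>2) \<le> \<sigma>\<^sup>2"
      using abs_Re_le_cmod[of "v\<^sup>2"] v by (simp add: norm_power)
    show "cmod (exp (- x\<^sup>2)) \<le> exp (- t\<^sup>2 + 2 * \<bar>t\<bar> * \<sigma> + \<sigma>\<^sup>2)"
      unfolding norm_exp_eq_Re exp_le_cancel_iff using b1 b2 b3 by linarith
  qed (fact assms)
  then show ?thesis
    unfolding gauss_deriv_of_real[symmetric] by simp
qed

definition hermite1 :: "nat \<Rightarrow> real \<Rightarrow> real" where
  "hermite1 k t = pi powr (- 1 / 4) * (- 1) ^ k * (2 ^ k * fact k) powr (- 1 / 2) * exp (t\<^sup>2 / 2) * gauss_deriv k t"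

lemma powr_neg_half_eq: "0 < x \<Longrightarrow> x powr (- 1 / 2) = 1 / sqrt x"
  using powr_minus[of x "1 / 2"] by (simp add: powr_half_sqrt inverse_eq_divide)

text \<open>The Taylor series of \<open>exp (- z\<^sup>2)\<close> at \<open>t\<close>, evaluated at \<open>t - w / \<surd>2\<close>.\<close>

lemma hermite1_generating_function:
  fixes w :: complex
  shows "((\<lambda>k. complex_of_real (hermite1 k t) * w ^ k / sqrt (fact k)) has_sum
      of_real (pi powr (- 1 / 4)) * exp (- (of_real t)\<^sup>2 / 2 + sqrt 2 * t * w - w\<^sup>2 / 2)) UNIV"
    and "(\<lambda>k. norm (complex_of_real (hermite1 k t) * w ^ k / sqrt (fact k))) summable_on UNIV"
proof -
  define v where "v = complex_of_real (- 1 / sqrt 2) * w"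
  define c where "c = pi powr (- 1 / 4) * exp (t\<^sup>2 / 2)"
  have summand: "complex_of_real (hermite1 k t) * w ^ k / sqrt (fact k) = c * (complex_of_real (gauss_deriv k t) / fact k * v ^ k)" for k
  proof -
    have "(2 ^ k * fact k :: real) powr (- 1 / 2) / sqrt (fact k) = 1 / (sqrt 2 ^ k * fact k)"
      by (subst powr_neg_half_eq) (auto simp: real_sqrt_mult real_sqrt_power)
    then have "hermite1 k t / sqrt (fact k) = c * (gauss_deriv k t / fact k * ((- 1) ^ k / sqrt 2 ^ k))"
      by (simp add: hermite1_def c_def field_simps)
    then have "complex_of_real (hermite1 k t / sqrt (fact k)) * w ^ k
        = complex_of_real (c * (gauss_deriv k t / fact k * ((- 1) ^ k / sqrt 2 ^ k))) * w ^ k"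
      by (simp only:)
    also have "\<dots> = c * (complex_of_real (gauss_deriv k t) / fact k * v ^ k)"
    proof -
      have "v ^ k = complex_of_real ((- 1) ^ k / sqrt 2 ^ k) * w ^ k"
        unfolding v_def power_mult_distrib of_real_power[symmetric] power_divide ..
      then show ?thesis
        by simp
    qed
    finally show ?thesis
      by simp
  qed
  have sums: "(\<lambda>k. complex_of_real (gauss_deriv k t) / fact k * v ^ k) sums exp (- (of_real t + v)\<^sup>2)"
    by (rule gauss_deriv_sums)
  have summable: "summable (\<lambda>k. norm (complex_of_real (gauss_deriv k t) / fact k * v ^ k))"
    using sums_summable[OF gauss_deriv_sums[of t "of_real (cmod v + 1)"]]
    by (intro powser_insidea[of "\<lambda>k. of_real (gauss_deriv k t) / fact k" "of_real (cmod v + 1)" v]) (auto simp del: of_real_add)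
  have "((\<lambda>k. c * (complex_of_real (gauss_deriv k t) / fact k * v ^ k)) has_sum c * exp (- (of_real t + v)\<^sup>2)) UNIV"
    by (intro has_sum_cmult_right norm_summable_imp_has_sum summable sums)
  also have "c * exp (- (of_real t + v)\<^sup>2)
      = of_real (pi powr (- 1 / 4)) * exp (- (of_real t)\<^sup>2 / 2 + sqrt 2 * t * w - w\<^sup>2 / 2)"
  proof -
    have "complex_of_real (sqrt 2) * sqrt 2 = 2"
      by (simp flip: of_real_mult)
    then have arg: "(complex_of_real t)\<^sup>2 / 2 + - (of_real t + v)\<^sup>2 = - (of_real t)\<^sup>2 / 2 + sqrt 2 * t * w - w\<^sup>2 / 2"
      by (simp add: v_def power2_eq_square field_simps)
    have "complex_of_real (exp (t\<^sup>2 / 2)) = exp ((of_real t)\<^sup>2 / 2)"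
      by (simp flip: exp_of_real)
    then show ?thesis
      by (simp only: c_def of_real_mult mult.assoc exp_add[symmetric] arg)
  qed
  finally show "((\<lambda>k. complex_of_real (hermite1 k t) * w ^ k / sqrt (fact k)) has_sum
      of_real (pi powr (- 1 / 4)) * exp (- (of_real t)\<^sup>2 / 2 + sqrt 2 * t * w - w\<^sup>2 / 2)) UNIV"
    by (simp only: summand)
  have "(\<lambda>k. cmod c * norm (complex_of_real (gauss_deriv k t) / fact k * v ^ k)) summable_on UNIV"
    using summable by (intro summable_on_cmult_right norm_summable_imp_summable_on) simp
  then show "(\<lambda>k. norm (complex_of_real (hermite1 k t) * w ^ k / sqrt (fact k))) summable_on UNIV"
    unfolding summand norm_mult .
qed

definition hermite_majorant1 :: "real \<Rightarrow> real \<Rightarrow> real" where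
  "hermite_majorant1 s t = pi powr (- 1 / 4) * exp (- t\<^sup>2 / 2 + sqrt 2 * s * \<bar>t\<bar> + s\<^sup>2 / 2)"

text \<open>This is \<open>gauss_deriv_bound\<close> with \<open>\<sigma> = s / \<surd>2\<close>, the scaling under which the powers of
  two cancel. Its virtue is that \<open>s\<close> is free: it can be adapted to the decay of given coefficients.\<close>

lemma hermite1_bound:
  assumes "s > 0"
  shows "\<bar>hermite1 k t\<bar> \<le> sqrt (fact k) / s ^ k * hermite_majorant1 s t"
proof -
  define \<sigma> where "\<sigma> = s / sqrt 2"
  have \<sigma>: "\<sigma> > 0"
    using assms by (simp add: \<sigma>_def)
  define c where "c = pi powr (- 1 / 4) * (2 ^ k * fact k) powr (- 1 / 2) * exp (t\<^sup>2 / 2)"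
  have "\<bar>hermite1 k t\<bar> = c * \<bar>gauss_deriv k t\<bar>"
    by (simp add: hermite1_def c_def abs_mult)
  also have "\<dots> \<le> c * (fact k / \<sigma> ^ k * exp (- t\<^sup>2 + 2 * \<bar>t\<bar> * \<sigma> + \<sigma>\<^sup>2))"
    by (intro mult_left_mono gauss_deriv_bound \<sigma>) (simp add: c_def)
  also have "\<dots> = pi powr (- 1 / 4) * ((2 ^ k * fact k) powr (- 1 / 2) * fact k / \<sigma> ^ k)
      * exp (t\<^sup>2 / 2 + (- t\<^sup>2 + 2 * \<bar>t\<bar> * \<sigma> + \<sigma>\<^sup>2))"
    by (simp add: c_def flip: exp_add)
  also have "t\<^sup>2 / 2 + (- t\<^sup>2 + 2 * \<bar>t\<bar> * \<sigma> + \<sigma>\<^sup>2) = - t\<^sup>2 / 2 + sqrt 2 * s * \<bar>t\<bar> + s\<^sup>2 / 2"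
  proof -
    have "2 * \<bar>t\<bar> * \<sigma> = sqrt 2 * s * \<bar>t\<bar>"
      by (simp add: \<sigma>_def real_div_sqrt[of 2, simplified] field_simps)
    then show ?thesis
      by (simp add: \<sigma>_def power_divide)
  qed
  also have "(2 ^ k * fact k) powr (- 1 / 2) * fact k / \<sigma> ^ k = sqrt (fact k) / s ^ k"
  proof -
    have eq: "(2 ^ k * fact k :: real) powr (- 1 / 2) = 1 / (sqrt 2 ^ k * sqrt (fact k))"
      by (subst powr_neg_half_eq) (auto simp: real_sqrt_mult real_sqrt_power)
    have "sqrt (fact k) * sqrt (fact k) = (fact k :: real)"
      by simp
    then show ?thesis
      unfolding eq using assms by (simp add: \<sigma>_def power_divide field_simps)
  qed
  finally show ?thesis
    by (simp add: hermite_majorant1_def mult_ac)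
qed

section \<open>Hermite functions of several variables\<close>

text \<open>The Gaussian is a product of functions of one variable, so each partial derivative acts on one
  factor and only the number of occurrences of each index matters.\<close>

lemma foldr_partial_deriv_gaussian:
  "foldr partial_deriv js (\<lambda>y. exp (- (norm y)\<^sup>2)) = (\<lambda>x :: real ^ 'n::finite. \<Prod>i\<in>UNIV. gauss_deriv (count_list js i) (x $ i))"
proof (induction js)
  case Nil
  show ?case
    by (simp add: gauss_deriv_0 norm_power2_vec exp_sum flip: sum_negf)
next
  case (Cons j js)
  show ?case
  proof
    fix x :: "real ^ 'n"
    define g where "g i t = gauss_deriv (count_list js i) ((x + t *\<^sub>R axis j 1) $ i)" for i t
    define P where "P = (\<Prod>i\<in>UNIV - {j}. gauss_deriv (count_list js i) (x $ i))"
    have split: "(\<Prod>i\<in>UNIV. h i) = h j * (\<Prod>i\<in>UNIV - {j}. h i)" for h :: "'n \<Rightarrow> real"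
      by (rule prod.remove) auto
    have "(\<Prod>i\<in>UNIV. gauss_deriv (count_list js i) ((x + t *\<^sub>R axis j 1) $ i))
        = gauss_deriv (count_list js j) (x $ j + t) * P" for t
      unfolding split by (auto simp: P_def axis_def intro!: prod.cong)
    moreover have "((\<lambda>t. gauss_deriv (count_list js j) (x $ j + t) * P) has_real_derivative
        gauss_deriv (Suc (count_list js j)) (x $ j) * P) (at 0)"
    proof -
      have "(gauss_deriv (count_list js j) has_real_derivative gauss_deriv (Suc (count_list js j)) (x $ j + 0)) (at (x $ j + 0))"
        by (rule has_real_derivative_gauss_deriv)
      then have "((\<lambda>t. gauss_deriv (count_list js j) (t + x $ j)) has_real_derivative gauss_deriv (Suc (count_list js j)) (x $ j)) (at 0)"
        by (subst DERIV_shift[symmetric]) (simp add: add.commute)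
      then show ?thesis
        by (intro DERIV_cmult_right) (simp add: add.commute)
    qed
    ultimately have "partial_deriv j (foldr partial_deriv js (\<lambda>y. exp (- (norm y)\<^sup>2))) x
        = gauss_deriv (Suc (count_list js j)) (x $ j) * P"
      unfolding Cons partial_deriv_def by (simp add: DERIV_imp_deriv)
    also have "\<dots> = (\<Prod>i\<in>UNIV. gauss_deriv (count_list (j # js) i) (x $ i))"
      unfolding split by (auto simp: P_def intro!: prod.cong)
    finally show "foldr partial_deriv (j # js) (\<lambda>y. exp (- (norm y)\<^sup>2)) x
        = (\<Prod>i\<in>UNIV. gauss_deriv (count_list (j # js) i) (x $ i))"
      by simp
  qed
qed

lemma ex_list_with_counts: "\<exists>js. \<forall>i. count_list js i = \<alpha> i" for \<alpha> :: "'n::finite \<Rightarrow> nat"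
proof -
  have "\<exists>js. \<forall>i. count_list js i = (if i \<in> A then \<alpha> i else 0)" for A
    using finite[of A]
  proof induction
    case empty
    show ?case
      by (intro exI[of _ "[]"]) simp
  next
    case (insert a A)
    then obtain js where "\<forall>i. count_list js i = (if i \<in> A then \<alpha> i else 0)"
      by blast
    moreover have "count_list (replicate n a) i = (if i = a then n else 0)" for n i
      by (induction n) auto
    ultimately show ?case
      using insert.hyps by (intro exI[of _ "replicate (\<alpha> a) a @ js"]) auto
  qed
  from this[of UNIV] show ?thesis
    by simp
qed

lemma mi_deriv_gaussian:
  "mi_deriv \<alpha> (\<lambda>y. exp (- (norm y)\<^sup>2)) x = (\<Prod>i\<in>UNIV. gauss_deriv (\<alpha> i) (x $ i))"
proof -
  have "count_list (SOME js. \<forall>i. count_list js i = \<alpha> i) i = \<alpha> i" for i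
    using someI_ex[OF ex_list_with_counts[of \<alpha>]] by blast
  then show ?thesis
    by (simp add: mi_deriv_def foldr_partial_deriv_gaussian)
qed

lemma hermite_fun_eq_prod: "hermite_fun \<alpha> x = (\<Prod>i\<in>UNIV. hermite1 (\<alpha> i) (x $ i))" for x :: "real ^ 'n::finite"
proof -
  have "(\<Prod>i\<in>(UNIV :: 'n set). pi powr (- 1 / 4)) = pi powr (- real CARD('n) / 4)"
    by (simp add: powr_power)
  moreover have "(\<Prod>i\<in>UNIV. (2 ^ \<alpha> i * fact (\<alpha> i)) powr (- 1 / 2)) = (2 ^ mi_abs \<alpha> * mi_fact \<alpha>) powr (- 1 / 2)"
    unfolding mi_fact_def prod_power_mi_abs[symmetric] prod.distrib[symmetric]
    by (subst prod_powr_distrib) auto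
  moreover have "(\<Prod>i\<in>UNIV. exp ((x $ i)\<^sup>2 / 2)) = exp ((norm x)\<^sup>2 / 2)"
    by (simp add: norm_power2_vec sum_divide_distrib exp_sum)
  moreover have "(\<Prod>i\<in>UNIV. (- 1 :: real) ^ \<alpha> i) = (- 1) ^ mi_abs \<alpha>"
    by (rule prod_power_mi_abs)
  ultimately show ?thesis
    by (simp only: hermite_fun_def hermite1_def mi_deriv_gaussian prod.distrib)
qed

lemma sqrt_mi_fact: "sqrt (mi_fact \<alpha>) = (\<Prod>i\<in>UNIV. sqrt (fact (\<alpha> i)))"
proof -
  have "sqrt (\<Prod>i\<in>A. fact (\<alpha> i)) = (\<Prod>i\<in>A. sqrt (fact (\<alpha> i)))" for A
    by (induction A rule: infinite_finite_induct) (auto simp: real_sqrt_mult)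
  then show ?thesis
    by (simp add: mi_fact_def)
qed

theorem hermite_generating_function:
  fixes x :: "real ^ 'n::finite" and w :: "complex ^ 'n"
  shows "((\<lambda>\<alpha>. complex_of_real (hermite_fun \<alpha> x) * mi_power w \<alpha> / sqrt (mi_fact \<alpha>)) has_sum
      (\<Prod>i\<in>UNIV. of_real (pi powr (- 1 / 4)) *
         exp (- (of_real (x $ i))\<^sup>2 / 2 + sqrt 2 * (x $ i) * (w $ i) - (w $ i)\<^sup>2 / 2))) UNIV"
proof -
  have eq: "complex_of_real (hermite_fun \<alpha> x) * mi_power w \<alpha> / sqrt (mi_fact \<alpha>)
      = (\<Prod>i\<in>UNIV. complex_of_real (hermite1 (\<alpha> i) (x $ i)) * (w $ i) ^ \<alpha> i / sqrt (fact (\<alpha> i)))" for \<alpha>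
    by (simp add: hermite_fun_eq_prod mi_power_def sqrt_mi_fact prod.distrib prod_dividef)
  show ?thesis
    unfolding eq by (rule has_sum_prod_multiindex(1)) (rule hermite1_generating_function)+
qed

definition hermite_majorant :: "real \<Rightarrow> real ^ 'n::finite \<Rightarrow> real" where
  "hermite_majorant s x = (\<Prod>i\<in>UNIV. hermite_majorant1 s (x $ i))"

lemma hermite_majorant_pos: "hermite_majorant s x > 0"
  by (simp add: hermite_majorant_def hermite_majorant1_def prod_pos)

lemma hermite_fun_bound:
  assumes "s > 0"
  shows "\<bar>hermite_fun \<alpha> x\<bar> \<le> sqrt (mi_fact \<alpha>) / s ^ mi_abs \<alpha> * hermite_majorant s x"
proof -
  have "\<bar>hermite_fun \<alpha> x\<bar> = (\<Prod>i\<in>UNIV. \<bar>hermite1 (\<alpha> i) (x $ i)\<bar>)"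
    by (simp add: hermite_fun_eq_prod abs_prod)
  also have "\<dots> \<le> (\<Prod>i\<in>UNIV. sqrt (fact (\<alpha> i)) / s ^ \<alpha> i * hermite_majorant1 s (x $ i))"
    by (intro prod_mono conjI hermite1_bound assms) auto
  also have "\<dots> = sqrt (mi_fact \<alpha>) / s ^ mi_abs \<alpha> * hermite_majorant s x"
    by (simp add: sqrt_mi_fact hermite_majorant_def prod.distrib prod_dividef prod_power_mi_abs)
  finally show ?thesis .
qed

lemma hermite_fun_measurable: "(hermite_fun \<alpha> :: real ^ 'n::finite \<Rightarrow> real) \<in> borel_measurable borel"
proof -
  have "continuous_on UNIV (gauss_deriv k)" for k
    using has_real_derivative_gauss_deriv DERIV_continuous_on[of UNIV "gauss_deriv k" "gauss_deriv (Suc k)"]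
    by (metis has_field_derivative_at_within)
  then have "continuous_on UNIV (hermite1 k)" for k
    unfolding hermite1_def[abs_def] by (intro continuous_intros) auto
  then have "continuous_on UNIV (\<lambda>x :: real ^ 'n. hermite1 k (x $ i))" for k and i :: 'n
    by (rule continuous_on_compose2) (auto intro: continuous_intros)
  then have "continuous_on UNIV (\<lambda>x. \<Prod>i\<in>UNIV. hermite1 (\<alpha> i) (x $ i))"
    by (intro continuous_on_prod)
  then show ?thesis
    unfolding hermite_fun_eq_prod[abs_def] by (rule borel_measurable_continuous_onI)
qed

text \<open>The square of the majorant is a constant times a product of functions
  \<open>exp (- t\<^sup>2 + c |t|)\<close>.\<close>

lemma nn_integral_hermite_majorant_square:
  assumes "s \<ge> 0"
  shows "(\<integral>\<^sup>+x. ennreal ((hermite_majorant s (x :: real ^ 'n::finite))\<^sup>2) \<partial>lebesgue) < \<infinity>"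
proof -
  have "(hermite_majorant1 s t)\<^sup>2 = (pi powr (- 1 / 4) * exp (s\<^sup>2 / 2))\<^sup>2 * exp (- t\<^sup>2 + (2 * sqrt 2 * s) * \<bar>t\<bar>)" for t
    by (simp add: hermite_majorant1_def power_mult_distrib exp_add flip: exp_double)
  then have eq: "(hermite_majorant s x)\<^sup>2 = ((pi powr (- 1 / 4) * exp (s\<^sup>2 / 2))\<^sup>2) ^ CARD('n) *
      (\<Prod>b\<in>Basis. exp (- (x \<bullet> b)\<^sup>2 + (2 * sqrt 2 * s) * \<bar>x \<bullet> b\<bar>))" for x :: "real ^ 'n"
  proof -
    assume *: "\<And>t. (hermite_majorant1 s t)\<^sup>2 = (pi powr (- 1 / 4) * exp (s\<^sup>2 / 2))\<^sup>2 * exp (- t\<^sup>2 + (2 * sqrt 2 * s) * \<bar>t\<bar>)"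
    have "bij_betw (\<lambda>i::'n. axis i (1::real)) UNIV Basis"
      by (auto simp: bij_betw_def inj_on_def axis_eq_axis Basis_vec_def)
    then have "(\<Prod>b\<in>Basis. exp (- (x \<bullet> b)\<^sup>2 + (2 * sqrt 2 * s) * \<bar>x \<bullet> b\<bar>))
        = (\<Prod>i\<in>UNIV. exp (- (x \<bullet> axis i 1)\<^sup>2 + (2 * sqrt 2 * s) * \<bar>x \<bullet> axis i 1\<bar>))"
      by (rule prod.reindex_bij_betw[symmetric])
    then show ?thesis
      by (simp add: hermite_majorant_def prod_power_distrib * prod.distrib inner_axis)
  qed
  have "(\<integral>\<^sup>+x. ennreal ((hermite_majorant s (x :: real ^ 'n))\<^sup>2) \<partial>lebesgue)
      = ennreal (((pi powr (- 1 / 4) * exp (s\<^sup>2 / 2))\<^sup>2) ^ CARD('n)) *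
        (\<integral>\<^sup>+x. ennreal (\<Prod>b\<in>Basis. exp (- (x \<bullet> b)\<^sup>2 + (2 * sqrt 2 * s) * \<bar>x \<bullet> b\<bar>)) \<partial>(lborel :: (real ^ 'n) measure))"
    unfolding eq by (simp add: nn_integral_completion ennreal_mult' nn_integral_cmult)
  also have "\<dots> < \<infinity>"
    using nn_integral_gaussian_bound_finite[of "2 * sqrt 2 * s", where 'a = "real ^ 'n"] assms
    by (simp add: ennreal_mult_less_top)
  finally show ?thesis .
qed

section \<open>Hermite series with factorially decaying coefficients\<close>

definition hermite_sum :: "(('n::finite \<Rightarrow> nat) \<Rightarrow> complex) \<Rightarrow> real ^ 'n \<Rightarrow> complex" where
  "hermite_sum c x = infsum (\<lambda>\<alpha>. c \<alpha> * complex_of_real (hermite_fun \<alpha> x)) UNIV"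

text \<open>By \<open>hermite_fun_bound\<close> the terms are dominated by \<open>C (r / s)\<^bsup>|\<alpha>|\<^esup>\<close> times the majorant. The
  second part controls all tails by a single square integrable function.\<close>

lemma hermite_series_estimates:
  fixes c :: "('n::finite \<Rightarrow> nat) \<Rightarrow> complex"
  assumes c: "\<And>\<alpha>. cmod (c \<alpha>) \<le> C * (r ^ mi_abs \<alpha> * mi_fact \<alpha> powr (- 1 / 2))" and r: "0 < r" "r < s"
  shows "((\<lambda>\<alpha>. c \<alpha> * complex_of_real (hermite_fun \<alpha> x)) has_sum hermite_sum c x) UNIV"
    and "finite A \<Longrightarrow> cmod (hermite_sum c x - (\<Sum>\<alpha>\<in>A. c \<alpha> * complex_of_real (hermite_fun \<alpha> x)))
      \<le> C * (infsum (\<lambda>\<alpha>. (r / s) ^ mi_abs \<alpha>) (UNIV :: ('n \<Rightarrow> nat) set) - (\<Sum>\<alpha>\<in>A. (r / s) ^ mi_abs \<alpha>)) * hermite_majorant s x"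
proof -
  define q where "q = r / s"
  have q: "0 \<le> q" "q < 1"
    using r by (simp_all add: q_def)
  have bound: "cmod (c \<alpha> * complex_of_real (hermite_fun \<alpha> x)) \<le> C * hermite_majorant s x * q ^ mi_abs \<alpha>" for \<alpha>
  proof -
    have "cmod (c \<alpha> * complex_of_real (hermite_fun \<alpha> x))
        \<le> (C * (r ^ mi_abs \<alpha> * mi_fact \<alpha> powr (- 1 / 2))) * (sqrt (mi_fact \<alpha>) / s ^ mi_abs \<alpha> * hermite_majorant s x)"
      using r hermite_majorant_pos[of s x] order_trans[OF norm_ge_zero c[of \<alpha>]] unfolding norm_mult norm_of_real
      by (intro mult_mono c hermite_fun_bound) auto
    also have "\<dots> = C * hermite_majorant s x * q ^ mi_abs \<alpha>"
      using mi_fact_pos[of \<alpha>] unfolding powr_neg_half_eq[OF mi_fact_pos] by (simp add: q_def power_divide)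
    finally show ?thesis .
  qed
  have geom: "(\<lambda>\<alpha> :: 'n \<Rightarrow> nat. q ^ mi_abs \<alpha>) summable_on UNIV"
    by (rule summable_geometric_multiindex[OF q])
  have abs: "(\<lambda>\<alpha>. norm (c \<alpha> * complex_of_real (hermite_fun \<alpha> x))) summable_on UNIV"
    using summable_on_cmult_right[OF geom] bound by (rule Infinite_Sum.abs_summable_on_comparison_test')
  show sum: "((\<lambda>\<alpha>. c \<alpha> * complex_of_real (hermite_fun \<alpha> x)) has_sum hermite_sum c x) UNIV"
    unfolding hermite_sum_def by (rule has_sum_infsum[OF Infinite_Sum.abs_summable_summable[OF abs]])
  assume A: "finite A"
  have tail: "((\<lambda>\<alpha>. c \<alpha> * complex_of_real (hermite_fun \<alpha> x)) has_sum
      (hermite_sum c x - (\<Sum>\<alpha>\<in>A. c \<alpha> * complex_of_real (hermite_fun \<alpha> x)))) (UNIV - A)"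
    by (rule has_sum_Diff[OF sum has_sum_finite[OF A]]) simp
  have tail_q: "((\<lambda>\<alpha>. C * hermite_majorant s x * q ^ mi_abs \<alpha>) has_sum
      C * hermite_majorant s x * (infsum (\<lambda>\<alpha>. q ^ mi_abs \<alpha>) (UNIV :: ('n \<Rightarrow> nat) set) - (\<Sum>\<alpha>\<in>A. q ^ mi_abs \<alpha>))) (UNIV - A)"
    by (intro has_sum_cmult_right has_sum_Diff has_sum_infsum[OF geom] has_sum_finite[OF A]) simp
  have tail_abs: "((\<lambda>\<alpha>. norm (c \<alpha> * complex_of_real (hermite_fun \<alpha> x))) has_sum
      infsum (\<lambda>\<alpha>. norm (c \<alpha> * complex_of_real (hermite_fun \<alpha> x))) (UNIV - A)) (UNIV - A)"
    by (rule has_sum_infsum[OF summable_on_subset_banach[OF abs]]) simp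
  have "cmod (hermite_sum c x - (\<Sum>\<alpha>\<in>A. c \<alpha> * complex_of_real (hermite_fun \<alpha> x)))
      \<le> C * hermite_majorant s x * (infsum (\<lambda>\<alpha>. q ^ mi_abs \<alpha>) (UNIV :: ('n \<Rightarrow> nat) set) - (\<Sum>\<alpha>\<in>A. q ^ mi_abs \<alpha>))"
    using norm_has_sum_bound[OF tail_abs tail] has_sum_mono[OF tail_abs tail_q bound] by (rule order_trans)
  then show "cmod (hermite_sum c x - (\<Sum>\<alpha>\<in>A. c \<alpha> * complex_of_real (hermite_fun \<alpha> x)))
      \<le> C * (infsum (\<lambda>\<alpha>. (r / s) ^ mi_abs \<alpha>) (UNIV :: ('n \<Rightarrow> nat) set) - (\<Sum>\<alpha>\<in>A. (r / s) ^ mi_abs \<alpha>)) * hermite_majorant s x"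
    by (simp add: q_def mult_ac)
qed

lemma hermite_sum_measurable:
  fixes c :: "('n::finite \<Rightarrow> nat) \<Rightarrow> complex"
  assumes c: "\<And>\<alpha>. cmod (c \<alpha>) \<le> C * (r ^ mi_abs \<alpha> * mi_fact \<alpha> powr (- 1 / 2))" and r: "0 < r"
  shows "hermite_sum c \<in> borel_measurable borel"
proof (rule has_sum_measurable[OF infinite_UNIV_multiindex])
  show "(\<lambda>x. c \<alpha> * complex_of_real (hermite_fun \<alpha> x)) \<in> borel_measurable borel" for \<alpha>
    using hermite_fun_measurable[of \<alpha>] by measurable
  show "((\<lambda>\<alpha>. c \<alpha> * complex_of_real (hermite_fun \<alpha> x)) has_sum hermite_sum c x) UNIV" for x
    by (rule hermite_series_estimates(1)[OF c r, of "r + 1"]) simp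
qed

text \<open>The majorant turns the pointwise estimate of the tails into convergence in \<open>L\<^sup>2\<close>.\<close>

lemma hermite_seriesI:
  fixes c :: "('n::finite \<Rightarrow> nat) \<Rightarrow> complex"
  assumes c: "\<And>\<alpha>. cmod (c \<alpha>) \<le> C * (r ^ mi_abs \<alpha> * mi_fact \<alpha> powr (- 1 / 2))" and r: "0 < r"
    and f: "AE x in lebesgue. f x = hermite_sum c x"
  shows "hermite_series c f"
proof -
  define s where "s = r + 1"
  have s: "0 \<le> s" "r < s"
    using r by (simp_all add: s_def)
  define t where "t A = C * (infsum (\<lambda>\<alpha>. (r / s) ^ mi_abs \<alpha>) (UNIV :: ('n \<Rightarrow> nat) set) - (\<Sum>\<alpha>\<in>A. (r / s) ^ mi_abs \<alpha>))" for A :: "('n \<Rightarrow> nat) set"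
  define u where "u \<alpha> x = c \<alpha> * complex_of_real (hermite_fun \<alpha> x)" for \<alpha> x
  define N where "N = (\<integral>\<^sup>+x. ennreal ((hermite_majorant s (x :: real ^ 'n))\<^sup>2) \<partial>lebesgue)"
  have N: "N < top"
    using nn_integral_hermite_majorant_square[OF s(1)] by (simp add: N_def)
  have "(t \<longlongrightarrow> C * (infsum (\<lambda>\<alpha>. (r / s) ^ mi_abs \<alpha>) (UNIV :: ('n \<Rightarrow> nat) set) - infsum (\<lambda>\<alpha>. (r / s) ^ mi_abs \<alpha>) (UNIV :: ('n \<Rightarrow> nat) set)))
      (finite_subsets_at_top UNIV)"
    unfolding t_def
    using has_sum_infsum[OF summable_geometric_multiindex[of "r / s"]] r s
    by (intro tendsto_intros) (auto simp: has_sum_def)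
  then have "((\<lambda>A. ennreal ((t A)\<^sup>2)) \<longlongrightarrow> ennreal (0\<^sup>2)) (finite_subsets_at_top UNIV)"
    by (intro tendsto_ennrealI tendsto_power) simp
  then have lim: "((\<lambda>A. N * ennreal ((t A)\<^sup>2)) \<longlongrightarrow> N * 0) (finite_subsets_at_top UNIV)"
    using N by (intro ennreal_tendsto_cmult) auto
  have le: "(\<integral>\<^sup>+x. ennreal ((cmod (f x - (\<Sum>\<alpha>\<in>A. u \<alpha> x)))\<^sup>2) \<partial>lebesgue) \<le> N * ennreal ((t A)\<^sup>2)" if "finite A" for A
  proof -
    have "(\<integral>\<^sup>+x. ennreal ((cmod (f x - (\<Sum>\<alpha>\<in>A. u \<alpha> x)))\<^sup>2) \<partial>lebesgue)
        \<le> (\<integral>\<^sup>+x. ennreal ((hermite_majorant s (x :: real ^ 'n))\<^sup>2) * ennreal ((t A)\<^sup>2) \<partial>lebesgue)"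
    proof (rule nn_integral_mono_AE)
      show "AE x in lebesgue. ennreal ((cmod (f x - (\<Sum>\<alpha>\<in>A. u \<alpha> x)))\<^sup>2)
          \<le> ennreal ((hermite_majorant s x)\<^sup>2) * ennreal ((t A)\<^sup>2)"
        using f
      proof eventually_elim
        case (elim x)
        have "cmod (f x - (\<Sum>\<alpha>\<in>A. u \<alpha> x)) \<le> t A * hermite_majorant s x"
          unfolding elim u_def t_def by (rule hermite_series_estimates(2)[OF c r s(2) that])
        then have "(cmod (f x - (\<Sum>\<alpha>\<in>A. u \<alpha> x)))\<^sup>2 \<le> (t A * hermite_majorant s x)\<^sup>2"
          by (intro power_mono) auto
        then show ?case
          by (simp add: power_mult_distrib mult.commute flip: ennreal_mult)
      qed
    qed
    also have "\<dots> = N * ennreal ((t A)\<^sup>2)"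
      unfolding N_def
    proof (rule nn_integral_multc)
      have "(hermite_majorant s :: real ^ 'n \<Rightarrow> real) \<in> borel_measurable borel"
        unfolding hermite_majorant_def[abs_def] hermite_majorant1_def
        by (intro borel_measurable_continuous_onI continuous_intros) auto
      then show "(\<lambda>x :: real ^ 'n. ennreal ((hermite_majorant s x)\<^sup>2)) \<in> borel_measurable lebesgue"
        by (intro borel_measurable_lebesgueI) measurable
    qed
    finally show ?thesis .
  qed
  show ?thesis
    unfolding hermite_series_def L2_has_sum_def u_def[symmetric]
  proof (rule tendsto_sandwich[OF _ _ tendsto_const])
    show "((\<lambda>A. N * ennreal ((t A)\<^sup>2)) \<longlongrightarrow> 0) (finite_subsets_at_top UNIV)"
      using lim by simp
    show "\<forall>\<^sub>F A in finite_subsets_at_top UNIV.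
        (\<integral>\<^sup>+x. ennreal ((cmod (f x - (\<Sum>\<alpha>\<in>A. u \<alpha> x)))\<^sup>2) \<partial>lebesgue) \<le> N * ennreal ((t A)\<^sup>2)"
      using le by (intro eventually_finite_subsets_at_top_weakI)
  qed simp
qed

text \<open>Both functions are approximated by the same partial sums, so
  \<open>|f - g|\<^sup>2 \<le> 2 |f - \<Sigma>|\<^sup>2 + 2 |g - \<Sigma>|\<^sup>2\<close> has integral zero in the limit.\<close>

lemma L2_has_sum_unique:
  fixes f g :: "'a::euclidean_space \<Rightarrow> complex"
  assumes f: "L2_has_sum u f" and g: "L2_has_sum u g"
    and meas: "f \<in> borel_measurable lebesgue" "g \<in> borel_measurable lebesgue" "\<And>k. u k \<in> borel_measurable lebesgue"
  shows "AE x in lebesgue. f x = g x"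
proof -
  define I where "I h A = (\<integral>\<^sup>+x. ennreal ((cmod (h x - (\<Sum>k\<in>A. u k x)))\<^sup>2) \<partial>lebesgue)" for h and A
  have [measurable]: "f \<in> borel_measurable lebesgue" "g \<in> borel_measurable lebesgue"
    "\<And>A. (\<lambda>x. \<Sum>k\<in>A. u k x) \<in> borel_measurable lebesgue"
    using meas by auto
  have "((\<lambda>A. 2 * I f A + 2 * I g A) \<longlongrightarrow> 2 * 0 + 2 * 0) (finite_subsets_at_top UNIV)"
    using f g unfolding L2_has_sum_def I_def
    by (intro tendsto_add ennreal_tendsto_cmult) auto
  moreover have "(\<integral>\<^sup>+x. ennreal ((cmod (f x - g x))\<^sup>2) \<partial>lebesgue) \<le> 2 * I f A + 2 * I g A" for A
  proof -
    have "(\<integral>\<^sup>+x. ennreal ((cmod (f x - g x))\<^sup>2) \<partial>lebesgue) \<le>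
      (\<integral>\<^sup>+x. 2 * ennreal ((cmod (f x - (\<Sum>k\<in>A. u k x)))\<^sup>2) + 2 * ennreal ((cmod (g x - (\<Sum>k\<in>A. u k x)))\<^sup>2) \<partial>lebesgue)"
    proof (rule nn_integral_mono)
      fix x
      define a b where "a = cmod (f x - (\<Sum>k\<in>A. u k x))" and "b = cmod (g x - (\<Sum>k\<in>A. u k x))"
      have "cmod (f x - g x) \<le> a + b"
        unfolding a_def b_def using norm_triangle_ineq4[of "f x - (\<Sum>k\<in>A. u k x)" "g x - (\<Sum>k\<in>A. u k x)"] by simp
      then have "(cmod (f x - g x))\<^sup>2 \<le> (a + b)\<^sup>2"
        by (intro power_mono) auto
      also have "\<dots> \<le> 2 * a\<^sup>2 + 2 * b\<^sup>2"
        using zero_le_power2[of "a - b"] by (simp add: power2_eq_square algebra_simps)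
      finally have "ennreal ((cmod (f x - g x))\<^sup>2) \<le> ennreal (2 * a\<^sup>2 + 2 * b\<^sup>2)"
        by (rule ennreal_leI)
      also have "\<dots> = 2 * ennreal (a\<^sup>2) + 2 * ennreal (b\<^sup>2)"
        by (simp add: ennreal_plus ennreal_mult')
      finally show "ennreal ((cmod (f x - g x))\<^sup>2) \<le> 2 * ennreal ((cmod (f x - (\<Sum>k\<in>A. u k x)))\<^sup>2)
          + 2 * ennreal ((cmod (g x - (\<Sum>k\<in>A. u k x)))\<^sup>2)"
        by (simp add: a_def b_def)
    qed
    also have "\<dots> = 2 * I f A + 2 * I g A"
      unfolding I_def by (subst nn_integral_add) (auto simp: nn_integral_cmult)
    finally show ?thesis .
  qed
  ultimately have "(\<integral>\<^sup>+x. ennreal ((cmod (f x - g x))\<^sup>2) \<partial>lebesgue) \<le> 2 * 0 + 2 * 0"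
    by (intro tendsto_lowerbound[where F = "finite_subsets_at_top UNIV"]) (auto intro: always_eventually)
  then have "(\<integral>\<^sup>+x. ennreal ((cmod (f x - g x))\<^sup>2) \<partial>lebesgue) = 0"
    by simp
  then have "AE x in lebesgue. ennreal ((cmod (f x - g x))\<^sup>2) = 0"
    by (subst (asm) nn_integral_0_iff_AE) measurable
  then show ?thesis
    by eventually_elim simp
qed

lemma hermite_series_AE_eq:
  fixes c :: "('n::finite \<Rightarrow> nat) \<Rightarrow> complex"
  assumes c: "\<And>\<alpha>. cmod (c \<alpha>) \<le> C * (r ^ mi_abs \<alpha> * mi_fact \<alpha> powr (- 1 / 2))" and r: "0 < r"
    and f: "hermite_series c f" "f \<in> borel_measurable lebesgue"
  shows "AE x in lebesgue. f x = hermite_sum c x"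
proof (rule L2_has_sum_unique)
  show "L2_has_sum (\<lambda>\<alpha> x. c \<alpha> * complex_of_real (hermite_fun \<alpha> x)) f"
    using f(1) by (simp add: hermite_series_def)
  show "L2_has_sum (\<lambda>\<alpha> x. c \<alpha> * complex_of_real (hermite_fun \<alpha> x)) (hermite_sum c)"
    using hermite_seriesI[OF c r, of "hermite_sum c"] by (simp add: hermite_series_def)
  show "hermite_sum c \<in> borel_measurable lebesgue"
    by (intro borel_measurable_lebesgueI hermite_sum_measurable[OF c r])
  show "(\<lambda>x. c \<alpha> * complex_of_real (hermite_fun \<alpha> x)) \<in> borel_measurable lebesgue" for \<alpha>
    using hermite_fun_measurable[of \<alpha>] by (intro borel_measurable_lebesgueI) measurable
qed (fact f(2))

section \<open>Hermite expansion of time-frequency shifted Gaussians\<close>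

definition phase_to_complex :: "(real ^ 'n::finite) \<times> (real ^ 'n) \<Rightarrow> complex ^ 'n" where
  "phase_to_complex p = (\<chi> i. Complex (fst p $ i) (snd p $ i))"

text \<open>The factor between a time-frequency shifted Gaussian and the generating function of the Hermite
  functions.\<close>

definition gauss_phase :: "(real ^ 'n::finite) \<times> (real ^ 'n) \<Rightarrow> complex" where
  "gauss_phase p = exp (complex_of_real (- (norm p)\<^sup>2 / 4) + \<i> * complex_of_real (fst p \<bullet> snd p) / 2)"

lemma linear_phase_to_complex: "linear phase_to_complex"
  by (rule linearI) (auto simp: phase_to_complex_def vec_eq_iff complex_eq_iff)

lemma distr_lborel_phase_to_complex:
  "distr lborel borel phase_to_complex = (lborel :: (complex ^ 'n::finite) measure)"
proof (rule distr_lborel_linear_Basis[OF linear_phase_to_complex])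
  have ax: "phase_to_complex (axis i 1, 0) = axis i 1" "phase_to_complex (0, axis i 1) = axis i \<i>" for i :: 'n
    by (auto simp: phase_to_complex_def axis_def vec_eq_iff complex_eq_iff)
  have "phase_to_complex ` (Basis :: ((real ^ 'n) \<times> (real ^ 'n)) set) = (\<Union>i. {axis i 1, axis i \<i>})"
    by (auto simp: Basis_prod_def Basis_vec_def image_Un image_UN ax image_image)
  also have "\<dots> = (Basis :: (complex ^ 'n) set)"
    by (auto simp: Basis_vec_def Basis_complex_def)
  finally have im: "phase_to_complex ` (Basis :: ((real ^ 'n) \<times> (real ^ 'n)) set) = Basis" .
  have "inj (phase_to_complex :: (real ^ 'n) \<times> (real ^ 'n) \<Rightarrow> complex ^ 'n)"
    by (auto simp: inj_def phase_to_complex_def vec_eq_iff)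
  with im show "bij_betw phase_to_complex Basis (Basis :: (complex ^ 'n) set)"
    by (auto simp: bij_betw_def intro: inj_on_subset)
qed

lemma norm_phase_to_complex: "norm (phase_to_complex p) = norm p"
proof -
  have "(norm (phase_to_complex p))\<^sup>2 = (norm p)\<^sup>2"
    unfolding norm_power2_vec
    by (cases p) (simp add: phase_to_complex_def norm_Pair norm_power2_vec cmod_power2 sum.distrib add_nonneg_nonneg sum_nonneg)
  then show ?thesis
    by simp
qed

lemma norm_gauss_phase: "cmod (gauss_phase p) = exp (- (norm p)\<^sup>2 / 4)"
  by (simp add: gauss_phase_def)

lemma phase_to_complex_measurable [measurable]: "phase_to_complex \<in> borel_measurable borel"
  by (intro borel_measurable_continuous_onI linear_continuous_on linear_linear[THEN iffD2] linear_phase_to_complex)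

lemma gauss_phase_measurable [measurable]: "gauss_phase \<in> borel_measurable borel"
  unfolding gauss_phase_def[abs_def] by (intro borel_measurable_continuous_onI continuous_intros) auto

text \<open>With \<open>w = (y + i \<eta>) / \<surd>2\<close> the generating function equals the shifted Gaussian up to a factor
  that does not depend on \<open>x\<close>; the exponents agree coordinate by coordinate.\<close>

lemma has_sum_shifted_gaussian:
  fixes x :: "real ^ 'n::finite"
  shows "((\<lambda>\<alpha>. complex_of_real (hermite_fun \<alpha> x / (sqrt (mi_fact \<alpha>) * sqrt 2 ^ mi_abs \<alpha>)) *
      (gauss_phase p * mi_power (phase_to_complex p) \<alpha>)) has_sum
      complex_of_real (gauss_window (x - fst p)) * exp (\<i> * complex_of_real (x \<bullet> snd p))) UNIV"
proof -
  obtain y \<eta> where p: "p = (y, \<eta>)"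
    by (cases p)
  define w where "w = (\<chi> i. phase_to_complex p $ i / sqrt 2)"
  have mi: "mi_power w \<alpha> = mi_power (phase_to_complex p) \<alpha> / sqrt 2 ^ mi_abs \<alpha>" for \<alpha>
    by (simp add: w_def mi_power_def power_divide prod_dividef prod_power_mi_abs)
  have s2: "complex_of_real (sqrt 2) * complex_of_real (sqrt 2) = 2"
    by (simp flip: of_real_mult)
  define E where "E i = - (complex_of_real (x $ i))\<^sup>2 / 2 + sqrt 2 * (x $ i) * (w $ i) - (w $ i)\<^sup>2 / 2" for i
  have E: "complex_of_real (- ((y $ i)\<^sup>2 + (\<eta> $ i)\<^sup>2) / 4) + \<i> * complex_of_real (y $ i * \<eta> $ i) / 2 + E i
      = complex_of_real (- (x $ i - y $ i)\<^sup>2 / 2) + \<i> * complex_of_real (x $ i * \<eta> $ i)" for i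
  proof -
    have w: "w $ i = (y $ i + \<i> * \<eta> $ i) / sqrt 2"
      by (simp add: w_def p phase_to_complex_def Complex_eq)
    have e1: "sqrt 2 * (x $ i) * (w $ i) = x $ i * (y $ i + \<i> * \<eta> $ i)"
      by (simp add: w)
    have e2: "(w $ i)\<^sup>2 = (y $ i + \<i> * \<eta> $ i)\<^sup>2 / 2"
      by (simp add: w power_divide power2_eq_square[of "complex_of_real (sqrt 2)"] s2)
    show ?thesis
      unfolding E_def e1 e2 by (simp add: power2_eq_square field_simps)
  qed
  have "gauss_phase p = exp (\<Sum>i\<in>UNIV. complex_of_real (- ((y $ i)\<^sup>2 + (\<eta> $ i)\<^sup>2) / 4) + \<i> * complex_of_real (y $ i * \<eta> $ i) / 2)"
  proof -
    have "(norm p)\<^sup>2 = (\<Sum>i\<in>UNIV. (y $ i)\<^sup>2 + (\<eta> $ i)\<^sup>2)"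
      by (simp add: p norm_Pair norm_power2_vec sum.distrib sum_nonneg)
    moreover have "fst p \<bullet> snd p = (\<Sum>i\<in>UNIV. y $ i * \<eta> $ i)"
      by (simp add: p inner_vec_def)
    ultimately show ?thesis
      by (simp add: gauss_phase_def sum.distrib sum_divide_distrib sum_distrib_left sum_negf sum_subtractf
          diff_divide_distrib)
  qed
  then have "gauss_phase p * (\<Prod>i\<in>UNIV. of_real (pi powr (- 1 / 4)) * exp (E i))
      = (\<Prod>i\<in>(UNIV :: 'n set). of_real (pi powr (- 1 / 4))) *
        exp (\<Sum>i\<in>UNIV. complex_of_real (- ((y $ i)\<^sup>2 + (\<eta> $ i)\<^sup>2) / 4) + \<i> * complex_of_real (y $ i * \<eta> $ i) / 2 + E i)"
    by (simp add: prod.distrib exp_sum exp_add)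
  also have "\<dots> = complex_of_real (\<Prod>i\<in>(UNIV :: 'n set). pi powr (- 1 / 4)) *
      exp (\<Sum>i\<in>UNIV. complex_of_real (- (x $ i - y $ i)\<^sup>2 / 2) + \<i> * complex_of_real (x $ i * \<eta> $ i))"
    unfolding E by simp
  also have "(\<Prod>i\<in>(UNIV :: 'n set). pi powr (- 1 / 4)) = pi powr (- real CARD('n) / 4)"
    by (simp add: powr_power)
  also have "(\<Sum>i\<in>UNIV. complex_of_real (- (x $ i - y $ i)\<^sup>2 / 2) + \<i> * complex_of_real (x $ i * \<eta> $ i))
      = complex_of_real (- (norm (x - y))\<^sup>2 / 2) + \<i> * complex_of_real (x \<bullet> \<eta>)"
    by (simp add: norm_power2_vec inner_vec_def sum.distrib sum_negf sum_divide_distrib sum_distrib_left sum_subtractf)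
  also have "complex_of_real (pi powr (- real CARD('n) / 4)) * exp (complex_of_real (- (norm (x - y))\<^sup>2 / 2) + \<i> * complex_of_real (x \<bullet> \<eta>))
      = complex_of_real (gauss_window (x - fst p)) * exp (\<i> * complex_of_real (x \<bullet> snd p))"
    by (simp only: gauss_window_def p fst_conv snd_conv exp_add exp_of_real of_real_mult mult.assoc)
  finally have kernel: "gauss_phase p * (\<Prod>i\<in>UNIV. of_real (pi powr (- 1 / 4)) * exp (E i))
      = complex_of_real (gauss_window (x - fst p)) * exp (\<i> * complex_of_real (x \<bullet> snd p))" .
  have "((\<lambda>\<alpha>. gauss_phase p * (complex_of_real (hermite_fun \<alpha> x) * mi_power w \<alpha> / sqrt (mi_fact \<alpha>))) has_sum
      gauss_phase p * (\<Prod>i\<in>UNIV. of_real (pi powr (- 1 / 4)) * exp (E i))) UNIV"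
    unfolding E_def by (intro has_sum_cmult_right hermite_generating_function)
  then show ?thesis
    unfolding kernel mi by (simp add: mult_ac)
qed

section \<open>The space of Groechenig\<close>

text \<open>The coefficient of \<open>h\<^sub>\<alpha>\<close> in \<open>V\<^sub>\<phi>\<^sup>* F\<close>, read off from \<open>has_sum_shifted_gaussian\<close>.\<close>

definition stft_hermite_coeff :: "((real ^ 'n::finite) \<times> (real ^ 'n) \<Rightarrow> complex) \<Rightarrow> ('n \<Rightarrow> nat) \<Rightarrow> complex" where
  "stft_hermite_coeff F \<alpha> =
     complex_of_real ((2 * pi) powr (- real CARD('n) / 2) / (sqrt (mi_fact \<alpha>) * sqrt 2 ^ mi_abs \<alpha>)) *
     (\<integral>p. F p * (gauss_phase p * mi_power (phase_to_complex p) \<alpha>) \<partial>lebesgue)"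

text \<open>Integrate the expansion of the shifted Gaussian against \<open>F\<close> term by term. On the support of
  \<open>F\<close> the monomials are at most \<open>\<rho>\<^bsup>|\<alpha>|\<^esup>\<close>; the Hermite bound with \<open>s = 2 \<rho>\<close> then makes
  the terms decay like \<open>2\<^bsup>-|\<alpha>|\<^esup>\<close>.\<close>

lemma stft_adjoint_eq_hermite_sum:
  fixes F :: "(real ^ 'n::finite) \<times> (real ^ 'n) \<Rightarrow> complex"
  assumes F: "F \<in> Linf_space" and supp: "AE p in lebesgue. p \<notin> cball 0 \<rho> \<longrightarrow> F p = 0" and "\<rho> > 0"
  shows "\<exists>C. \<forall>\<alpha>. cmod (stft_hermite_coeff F \<alpha>) \<le> C * (\<rho> ^ mi_abs \<alpha> * mi_fact \<alpha> powr (- 1 / 2))"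
    and "stft_adjoint gauss_window F x = hermite_sum (stft_hermite_coeff F) x"
proof -
  define c where "c = stft_hermite_coeff F"
  obtain B0 where B0: "AE p in lebesgue. cmod (F p) \<le> B0" and F_meas: "F \<in> borel_measurable lebesgue"
    using F by (auto simp: Linf_space_def)
  define B where "B = max B0 0"
  have B: "B \<ge> 0"
    by (simp add: B_def)
  define g where "g \<alpha> p = F p * (gauss_phase p * mi_power (phase_to_complex p) \<alpha>)" for \<alpha> p
  have g_bound: "AE p in lebesgue. cmod (g \<alpha> p) \<le> B * \<rho> ^ mi_abs \<alpha> * indicator (cball 0 \<rho>) p" for \<alpha>
    using B0 supp
  proof eventually_elim
    case (elim p)
    show ?case
    proof (cases "p \<in> cball 0 \<rho>")
      case True
      then have "phase_to_complex p \<in> polydisc \<rho>"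
        using cball_subset_polydisc[of \<rho>] by (auto simp: norm_phase_to_complex)
      then have 1: "cmod (mi_power (phase_to_complex p) \<alpha>) \<le> \<rho> ^ mi_abs \<alpha>"
        by (rule norm_mi_power_le)
      have 2: "cmod (gauss_phase p) \<le> 1"
        by (simp add: norm_gauss_phase)
      have "cmod (g \<alpha> p) \<le> B * (1 * \<rho> ^ mi_abs \<alpha>)"
        unfolding g_def norm_mult using elim 1 2 \<open>\<rho> > 0\<close> B
        by (intro mult_mono) (auto simp: B_def)
      with True show ?thesis
        by simp
    qed (use elim in \<open>simp add: g_def\<close>)
  qed
  have g_meas: "g \<alpha> \<in> borel_measurable lebesgue" for \<alpha>
    unfolding g_def by (intro borel_measurable_times F_meas borel_measurable_lebesgueI measurable_compose[OF phase_to_complex_measurable mi_power_measurable])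
      measurable
  have fin: "emeasure lebesgue (cball 0 \<rho> :: ((real ^ 'n) \<times> (real ^ 'n)) set) < \<infinity>"
    using emeasure_bounded_finite[OF bounded_cball] by (simp add: emeasure_completion)
  have ind: "integrable lebesgue (\<lambda>p :: (real ^ 'n) \<times> (real ^ 'n). B * \<rho> ^ mi_abs \<alpha> * indicat_real (cball 0 \<rho>) p)"
    for \<alpha> :: "'n \<Rightarrow> nat"
    by (intro integrable_mult_right integrable_real_indicator fin) auto
  have g_int: "integrable lebesgue (g \<alpha>)" for \<alpha>
    by (rule Bochner_Integration.integrable_bound[OF ind g_meas])
      (use g_bound[of \<alpha>] in eventually_elim, use B \<open>\<rho> > 0\<close> in auto)
  define m where "m = measure lebesgue (cball 0 \<rho> :: ((real ^ 'n) \<times> (real ^ 'n)) set)"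
  have g_norm: "(\<integral>p. cmod (g \<alpha> p) \<partial>lebesgue) \<le> B * m * \<rho> ^ mi_abs \<alpha>" for \<alpha>
    using integral_mono_AE[OF integrable_norm[OF g_int] ind g_bound, of \<alpha>]
    by (simp add: m_def mult_ac)
  define k where "k = (2 * pi) powr (- real CARD('n) / 2)"
  have "k \<ge> 0"
    by (simp add: k_def)
  have c_eq: "c \<alpha> = complex_of_real (k / (sqrt (mi_fact \<alpha>) * sqrt 2 ^ mi_abs \<alpha>)) * (\<integral>p. g \<alpha> p \<partial>lebesgue)" for \<alpha>
    by (simp add: c_def stft_hermite_coeff_def g_def k_def)
  have fac: "1 / (sqrt (mi_fact \<alpha>) * sqrt 2 ^ mi_abs \<alpha>) \<le> mi_fact \<alpha> powr (- 1 / 2)" for \<alpha> :: "'n \<Rightarrow> nat"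
  proof -
    have "sqrt (mi_fact \<alpha>) * 1 \<le> sqrt (mi_fact \<alpha>) * sqrt 2 ^ mi_abs \<alpha>"
      using mi_fact_pos[of \<alpha>] by (intro mult_left_mono one_le_power) auto
    then show ?thesis
      unfolding powr_neg_half_eq[OF mi_fact_pos] using mi_fact_pos[of \<alpha>]
      by (intro frac_le) auto
  qed
  have c_bound: "cmod (c \<alpha>) \<le> (k * B * m) * (\<rho> ^ mi_abs \<alpha> * mi_fact \<alpha> powr (- 1 / 2))" for \<alpha>
  proof -
    have "cmod (c \<alpha>) = k * (1 / (sqrt (mi_fact \<alpha>) * sqrt 2 ^ mi_abs \<alpha>)) * cmod (\<integral>p. g \<alpha> p \<partial>lebesgue)"
      using \<open>k \<ge> 0\<close> mi_fact_pos[of \<alpha>] by (simp add: c_eq norm_mult norm_divide norm_power)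
    also have "\<dots> \<le> k * mi_fact \<alpha> powr (- 1 / 2) * (B * m * \<rho> ^ mi_abs \<alpha>)"
      using fac[of \<alpha>] \<open>k \<ge> 0\<close> order_trans[OF integral_norm_bound g_norm]
      by (intro mult_mono mult_left_mono) auto
    finally show ?thesis
      by (simp add: mult_ac)
  qed
  then show "\<exists>C. \<forall>\<alpha>. cmod (stft_hermite_coeff F \<alpha>) \<le> C * (\<rho> ^ mi_abs \<alpha> * mi_fact \<alpha> powr (- 1 / 2))"
    unfolding c_def by blast
  show "stft_adjoint gauss_window F x = hermite_sum (stft_hermite_coeff F) x"
  proof -
    define u where "u \<alpha> = complex_of_real (hermite_fun \<alpha> x / (sqrt (mi_fact \<alpha>) * sqrt 2 ^ mi_abs \<alpha>))" for \<alpha>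
    define K where "K p = complex_of_real (gauss_window (x - fst p)) * exp (\<i> * complex_of_real (x \<bullet> snd p))" for p
    have u_norm: "cmod (u \<alpha>) \<le> hermite_majorant (2 * \<rho>) x / (2 * \<rho>) ^ mi_abs \<alpha>" for \<alpha>
    proof -
      have "cmod (u \<alpha>) = \<bar>hermite_fun \<alpha> x\<bar> * (1 / (sqrt (mi_fact \<alpha>) * sqrt 2 ^ mi_abs \<alpha>))"
        using mi_fact_pos[of \<alpha>] unfolding u_def norm_of_real by (simp add: abs_mult)
      also have "\<dots> \<le> (sqrt (mi_fact \<alpha>) / (2 * \<rho>) ^ mi_abs \<alpha> * hermite_majorant (2 * \<rho>) x) * mi_fact \<alpha> powr (- 1 / 2)"
        using mi_fact_pos[of \<alpha>] \<open>\<rho> > 0\<close> hermite_majorant_pos[of "2 * \<rho>" x]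
        by (intro mult_mono fac hermite_fun_bound) auto
      also have "\<dots> = hermite_majorant (2 * \<rho>) x / (2 * \<rho>) ^ mi_abs \<alpha>"
        unfolding powr_neg_half_eq[OF mi_fact_pos] using mi_fact_pos[of \<alpha>] by simp
      finally show ?thesis .
    qed
    have pt: "((\<lambda>\<alpha>. u \<alpha> * g \<alpha> p) has_sum F p * K p) UNIV" for p
      using has_sum_cmult_right[OF has_sum_shifted_gaussian[of x p], of "F p"]
      by (simp add: u_def g_def K_def mult_ac)
    have "((\<lambda>\<alpha>. \<integral>p. u \<alpha> * g \<alpha> p \<partial>lebesgue) has_sum (\<integral>p. F p * K p \<partial>lebesgue)) UNIV"
    proof (rule has_sum_integral[OF infinite_UNIV_multiindex _ _ _ pt])
      show "integrable lebesgue (\<lambda>p. u \<alpha> * g \<alpha> p)" for \<alpha>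
        by (intro integrable_mult_right g_int)
      show "(\<lambda>\<alpha>. norm (u \<alpha> * g \<alpha> p)) summable_on UNIV" for p
        using has_sum_imp_summable[OF pt[of p]]
        by (rule summable_on_iff_abs_summable_on_complex[THEN iffD1])
      have "(\<lambda>\<alpha> :: 'n \<Rightarrow> nat. hermite_majorant (2 * \<rho>) x * B * m * (1 / 2) ^ mi_abs \<alpha>) summable_on UNIV"
        by (intro summable_on_cmult_right summable_geometric_multiindex) auto
      then show "(\<lambda>\<alpha>. \<integral>p. norm (u \<alpha> * g \<alpha> p) \<partial>lebesgue) summable_on UNIV"
      proof (rule summable_on_comparison_test)
        fix \<alpha> :: "'n \<Rightarrow> nat"
        have "(\<integral>p. norm (u \<alpha> * g \<alpha> p) \<partial>lebesgue) = cmod (u \<alpha>) * (\<integral>p. cmod (g \<alpha> p) \<partial>lebesgue)"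
          by (simp add: norm_mult)
        also have "\<dots> \<le> (hermite_majorant (2 * \<rho>) x / (2 * \<rho>) ^ mi_abs \<alpha>) * (B * m * \<rho> ^ mi_abs \<alpha>)"
          using hermite_majorant_pos[of "2 * \<rho>" x] \<open>\<rho> > 0\<close>
          by (intro mult_mono u_norm g_norm) auto
        also have "\<dots> = hermite_majorant (2 * \<rho>) x * B * m * (1 / 2) ^ mi_abs \<alpha>"
          using \<open>\<rho> > 0\<close> by (simp add: power_mult_distrib power_divide)
        finally show "(\<integral>p. norm (u \<alpha> * g \<alpha> p) \<partial>lebesgue) \<le> hermite_majorant (2 * \<rho>) x * B * m * (1 / 2) ^ mi_abs \<alpha>" .
      qed simp
    qed
    then have "((\<lambda>\<alpha>. k * (\<integral>p. u \<alpha> * g \<alpha> p \<partial>lebesgue)) has_sum k * (\<integral>p. F p * K p \<partial>lebesgue)) UNIV"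
      by (rule has_sum_cmult_right)
    moreover have "k * (\<integral>p. u \<alpha> * g \<alpha> p \<partial>lebesgue) = c \<alpha> * complex_of_real (hermite_fun \<alpha> x)" for \<alpha>
      by (simp add: c_eq u_def)
    moreover have "k * (\<integral>p. F p * K p \<partial>lebesgue) = stft_adjoint gauss_window F x"
      by (simp add: stft_adjoint_def K_def k_def case_prod_unfold mult.assoc)
    ultimately have "((\<lambda>\<alpha>. c \<alpha> * complex_of_real (hermite_fun \<alpha> x)) has_sum stft_adjoint gauss_window F x) UNIV"
      by simp
    then show ?thesis
      unfolding hermite_sum_def c_def by (simp add: infsumI)
  qed
qed

section \<open>Comparison with the Hermite series spaces\<close>

lemma S_C_subset_H_flat1: "(S_C :: (real ^ 'n::finite \<Rightarrow> complex) set) \<subseteq> H_flat1"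
proof
  fix f :: "real ^ 'n \<Rightarrow> complex"
  assume "f \<in> S_C"
  then obtain F where f: "f \<in> L2_space" and F: "F \<in> Linf_space" and cpt: "compact (ess_support F)"
    and eq: "AE x in lebesgue. f x = stft_adjoint gauss_window F x"
    unfolding S_C_def by blast
  obtain \<rho> where \<rho>: "\<rho> > 0" "ess_support F \<subseteq> cball 0 \<rho>"
    using compact_imp_bounded[OF cpt] unfolding bounded_pos by (auto simp: subset_iff)
  have "AE p in lebesgue. p \<notin> cball 0 \<rho> \<longrightarrow> F p = 0"
    using AE_notin_ess_support[of F] by eventually_elim (use \<rho> in blast)
  note expansion = stft_adjoint_eq_hermite_sum[OF F this \<rho>(1)]
  define c where "c = stft_hermite_coeff F"
  obtain C where c: "\<And>\<alpha>. cmod (c \<alpha>) \<le> C * (\<rho> ^ mi_abs \<alpha> * mi_fact \<alpha> powr (- 1 / 2))"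
    using expansion(1) unfolding c_def by blast
  have "hermite_series c f"
    using eq unfolding expansion(2) c_def[symmetric] by (rule hermite_seriesI[OF c \<rho>(1)])
  with f c \<rho>(1) show "f \<in> H_flat1"
    unfolding H_flat1_def by blast
qed

lemma norm_le_of_polydisc:
  fixes w :: "complex ^ 'n::finite"
  assumes "w \<in> polydisc R"
  shows "norm w \<le> real CARD('n) * R"
proof -
  have "norm w \<le> (\<Sum>i\<in>UNIV. norm (w $ i))"
    unfolding norm_vec_def by (rule L2_set_le_sum) simp
  also have "\<dots> \<le> real CARD('n) * R"
    using assms by (intro sum_bounded_above) (auto simp: polydisc_def)
  finally show ?thesis .
qed

text \<open>Prescribe the moments that the coefficients of the series require. In
  \<open>stft_hermite_coeff\<close> the monomials are not conjugated, so the moment theorem is applied to the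
  conjugate sequence.\<close>

lemma H_flat1_subset_S_C: "(H_flat1 :: (real ^ 'n::finite \<Rightarrow> complex) set) \<subseteq> S_C"
proof
  fix f :: "real ^ 'n \<Rightarrow> complex"
  assume "f \<in> H_flat1"
  then obtain c r C where f: "f \<in> L2_space" and ser: "hermite_series c f" and r: "r > 0"
    and c: "\<And>\<alpha>. cmod (c \<alpha>) \<le> C * (r ^ mi_abs \<alpha> * mi_fact \<alpha> powr (- 1 / 2))"
    unfolding H_flat1_def by blast
  have f_meas: "f \<in> borel_measurable lebesgue"
    using f by (simp add: L2_space_def)
  define b where "b \<alpha> = c \<alpha> * complex_of_real (sqrt (mi_fact \<alpha>) * sqrt 2 ^ mi_abs \<alpha>)" for \<alpha>
  define R0 where "R0 = sqrt 2 * r"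
  define R where "R = R0 + 1"
  have R: "0 < R0" "R0 < R"
    using r by (simp_all add: R0_def R_def)
  have "cmod (cnj (b \<alpha>)) \<le> C * R0 ^ mi_abs \<alpha>" for \<alpha>
  proof -
    have "cmod (cnj (b \<alpha>)) = cmod (c \<alpha>) * (sqrt (mi_fact \<alpha>) * sqrt 2 ^ mi_abs \<alpha>)"
      using mi_fact_pos[of \<alpha>] unfolding b_def by (simp only: complex_mod_cnj norm_mult norm_of_real) (simp add: abs_mult)
    also have "\<dots> \<le> (C * (r ^ mi_abs \<alpha> * mi_fact \<alpha> powr (- 1 / 2))) * (sqrt (mi_fact \<alpha>) * sqrt 2 ^ mi_abs \<alpha>)"
      using mi_fact_pos[of \<alpha>] by (intro mult_right_mono c) auto
    also have "\<dots> = C * R0 ^ mi_abs \<alpha>"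
      unfolding powr_neg_half_eq[OF mi_fact_pos] using mi_fact_pos[of \<alpha>] by (simp add: R0_def power_mult_distrib)
    finally show ?thesis .
  qed
  then obtain G :: "complex ^ 'n \<Rightarrow> complex" and B where G_meas: "G \<in> borel_measurable borel" and G_bound: "\<And>w. cmod (G w) \<le> B"
    and G_out: "\<And>w. w \<notin> polydisc R \<Longrightarrow> G w = 0"
    and moments: "\<And>\<alpha>. (\<integral>w. gauss_density w * (G w * cnj (mi_power w \<alpha>)) \<partial>lborel) = cnj (b \<alpha>)"
    by (rule bounded_function_with_moments[OF _ R]) (rule that)
  have [measurable]: "cnj \<in> borel_measurable borel"
    by (intro borel_measurable_continuous_onI continuous_intros)
  note [measurable] = G_meas
  define H where "H \<alpha> w = complex_of_real (gauss_density w) * (cnj (G w) * mi_power w \<alpha>)" for \<alpha> w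
  have H_meas [measurable]: "H \<alpha> \<in> borel_measurable borel" for \<alpha>
    unfolding H_def by measurable
  have H_int: "(\<integral>w. H \<alpha> w \<partial>lborel) = b \<alpha>" for \<alpha>
  proof -
    have "(\<integral>w. H \<alpha> w \<partial>lborel) = (\<integral>w. cnj (gauss_density w * (G w * cnj (mi_power w \<alpha>))) \<partial>lborel)"
      by (simp add: H_def)
    also have "\<dots> = cnj (cnj (b \<alpha>))"
      by (subst Bochner_Integration.integral_cnj) (simp add: moments)
    finally show ?thesis
      by simp
  qed
  define k where "k = (2 * pi) powr (real CARD('n) / 2)"
  \<comment> \<open>Dividing by the phase factor leaves a bounded function, because the Gaussian density decays faster.\<close>
  define F where "F p = complex_of_real k * (complex_of_real (gauss_density (phase_to_complex p)) * cnj (G (phase_to_complex p)) / gauss_phase p)"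
    for p :: "(real ^ 'n) \<times> (real ^ 'n)"
  have F_meas: "F \<in> borel_measurable borel"
    unfolding F_def by measurable
  have F_bound: "cmod (F p) \<le> k * pi powr (- real CARD('n)) * B" for p
  proof -
    have "gauss_density (phase_to_complex p) / cmod (gauss_phase p) = pi powr (- real CARD('n)) * exp (- (norm p)\<^sup>2 - (- (norm p)\<^sup>2 / 4))"
      by (simp only: gauss_density_def norm_gauss_phase norm_phase_to_complex exp_diff times_divide_eq_right)
    also have "\<dots> \<le> pi powr (- real CARD('n))"
      by (intro mult_left_le) auto
    finally have "k * (gauss_density (phase_to_complex p) / cmod (gauss_phase p)) * cmod (G (phase_to_complex p)) \<le> k * pi powr (- real CARD('n)) * B"
      using G_bound[of "phase_to_complex p"] by (intro mult_mono mult_left_mono) (auto simp: k_def gauss_density_nonneg)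
    then show ?thesis
      by (simp add: F_def norm_mult norm_divide gauss_density_nonneg k_def)
  qed
  have F_Linf: "F \<in> Linf_space"
    unfolding Linf_space_def
    by (intro CollectI conjI borel_measurable_lebesgueI F_meas
        exI[of _ "k * pi powr (- real CARD('n)) * B"] AE_I2) (rule F_bound)
  define \<rho> where "\<rho> = real CARD('n) * R"
  have "\<rho> > 0"
    using R by (simp add: \<rho>_def)
  have F_out: "F p = 0" if "p \<notin> cball 0 \<rho>" for p
  proof -
    have "phase_to_complex p \<notin> polydisc R"
      using norm_le_of_polydisc[of "phase_to_complex p" R] that by (auto simp: norm_phase_to_complex \<rho>_def)
    then show ?thesis
      by (simp add: F_def G_out)
  qed
  have "ess_support F \<subseteq> cball 0 \<rho>"
    by (rule ess_support_subset[OF closed_cball F_out])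
  then have cpt: "compact (ess_support F)"
    using closed_ess_support bounded_subset[OF bounded_cball] by (auto simp: compact_eq_bounded_closed)
  have c_eq: "stft_hermite_coeff F \<alpha> = c \<alpha>" for \<alpha>
  proof -
    have ph: "gauss_phase p \<noteq> 0" for p :: "(real ^ 'n) \<times> (real ^ 'n)"
      by (simp add: gauss_phase_def)
    have "(\<integral>p. F p * (gauss_phase p * mi_power (phase_to_complex p) \<alpha>) \<partial>lebesgue) = (\<integral>p. k * H \<alpha> (phase_to_complex p) \<partial>lebesgue)"
      by (intro Bochner_Integration.integral_cong refl) (simp add: F_def H_def ph mult_ac)
    also have "\<dots> = (\<integral>p. k * H \<alpha> (phase_to_complex p) \<partial>lborel)"
      by (intro integral_completion) measurable
    also have "\<dots> = k * (\<integral>w. H \<alpha> w \<partial>distr lborel borel phase_to_complex)"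
      by (simp add: integral_distr)
    also have "\<dots> = k * b \<alpha>"
      by (simp add: distr_lborel_phase_to_complex H_int)
    finally have int: "(\<integral>p. F p * (gauss_phase p * mi_power (phase_to_complex p) \<alpha>) \<partial>lebesgue) = k * b \<alpha>" .
    have "(2 * pi) powr (- real CARD('n) / 2) * k = 1"
      by (simp add: k_def flip: powr_add)
    moreover have "sqrt (mi_fact \<alpha>) * sqrt 2 ^ mi_abs \<alpha> \<noteq> 0"
      using mi_fact_pos[of \<alpha>] by simp
    ultimately have "(2 * pi) powr (- real CARD('n) / 2) / (sqrt (mi_fact \<alpha>) * sqrt 2 ^ mi_abs \<alpha>) * k * (sqrt (mi_fact \<alpha>) * sqrt 2 ^ mi_abs \<alpha>) = 1"
      by (simp add: field_simps)
    then have "complex_of_real ((2 * pi) powr (- real CARD('n) / 2) / (sqrt (mi_fact \<alpha>) * sqrt 2 ^ mi_abs \<alpha>)) * k *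
        complex_of_real (sqrt (mi_fact \<alpha>) * sqrt 2 ^ mi_abs \<alpha>) = 1"
      unfolding of_real_mult[symmetric] by (simp only: of_real_1)
    then show ?thesis
      unfolding stft_hermite_coeff_def int b_def by (metis mult.assoc mult.commute mult_1)
  qed
  have "stft_hermite_coeff F = c"
    by (rule ext) (rule c_eq)
  then have "stft_adjoint gauss_window F x = hermite_sum c x" for x
    using stft_adjoint_eq_hermite_sum(2)[OF F_Linf _ \<open>\<rho> > 0\<close>] F_out by simp
  with hermite_series_AE_eq[OF c r ser f_meas] have "AE x in lebesgue. f x = stft_adjoint gauss_window F x"
    by simp
  with f F_Linf cpt show "f \<in> S_C"
    unfolding S_C_def by blast
qed

lemma H0_flat1_subset_H_flat1: "H0_flat1 \<subseteq> H_flat1"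
proof
  fix f :: "real ^ 'n \<Rightarrow> complex"
  assume "f \<in> H0_flat1"
  then obtain c where f: "f \<in> L2_space" "hermite_series c f"
    and c: "\<forall>r>0. \<exists>C. \<forall>\<alpha>. cmod (c \<alpha>) \<le> C * (r ^ mi_abs \<alpha> * mi_fact \<alpha> powr (-1/2))"
    unfolding H0_flat1_def by blast
  from c have "\<exists>C. \<forall>\<alpha>. cmod (c \<alpha>) \<le> C * (1 ^ mi_abs \<alpha> * mi_fact \<alpha> powr (-1/2))"
    using zero_less_one by blast
  then have "\<exists>r>0. \<exists>C. \<forall>\<alpha>. cmod (c \<alpha>) \<le> C * (r ^ mi_abs \<alpha> * mi_fact \<alpha> powr (-1/2))"
    using zero_less_one by blast
  with f show "f \<in> H_flat1"
    unfolding H_flat1_def by blast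
qed

text \<open>The Gaussian centred at \<open>(\<surd>2, ..., \<surd>2)\<close> is the generating function at \<open>w = (1, ..., 1)\<close>, up to
  a constant factor.
  If it belonged to the smaller space, it would be dominated by the majorant with parameter
  \<open>s = 1/2\<close>, which fails far out in the positive orthant.\<close>

lemma H0_flat1_neq_H_flat1: "(H0_flat1 :: (real ^ 'n::finite \<Rightarrow> complex) set) \<noteq> H_flat1"
proof
  assume eq: "(H0_flat1 :: (real ^ 'n \<Rightarrow> complex) set) = H_flat1"
  define c :: "('n \<Rightarrow> nat) \<Rightarrow> complex" where "c \<alpha> = complex_of_real (1 / sqrt (mi_fact \<alpha>))" for \<alpha>
  define f where "f = hermite_sum c"
  have c: "cmod (c \<alpha>) \<le> 1 * (1 ^ mi_abs \<alpha> * mi_fact \<alpha> powr (- 1 / 2))" for \<alpha>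
    using mi_fact_pos[of \<alpha>] unfolding c_def norm_of_real powr_neg_half_eq[OF mi_fact_pos] by simp
  have f_eq: "f x = complex_of_real (\<Prod>i\<in>UNIV. pi powr (- 1 / 4) * exp (- (x $ i)\<^sup>2 / 2 + sqrt 2 * (x $ i) - 1 / 2))" for x
  proof -
    define w :: "complex ^ 'n" where "w = (\<chi> i. 1)"
    have "((\<lambda>\<alpha>. c \<alpha> * complex_of_real (hermite_fun \<alpha> x)) has_sum
        (\<Prod>i\<in>UNIV. of_real (pi powr (- 1 / 4)) *
         exp (- (of_real (x $ i))\<^sup>2 / 2 + sqrt 2 * (x $ i) * (w $ i) - (w $ i)\<^sup>2 / 2))) UNIV"
      using hermite_generating_function[of x w] by (simp add: c_def w_def mi_power_def)
    then have "f x = (\<Prod>i\<in>UNIV. of_real (pi powr (- 1 / 4)) *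
         exp (- (of_real (x $ i))\<^sup>2 / 2 + sqrt 2 * (x $ i) * (w $ i) - (w $ i)\<^sup>2 / 2))"
      unfolding f_def hermite_sum_def by (rule infsumI)
    also have "\<dots> = (\<Prod>i\<in>UNIV. complex_of_real (pi powr (- 1 / 4) * exp (- (x $ i)\<^sup>2 / 2 + sqrt 2 * (x $ i) - 1 / 2)))"
      by (simp add: w_def flip: exp_of_real)
    finally show ?thesis
      by simp
  qed
  have f_meas: "f \<in> borel_measurable lebesgue"
    unfolding f_def by (intro borel_measurable_lebesgueI hermite_sum_measurable[OF c]) simp
  have "f \<in> L2_space"
  proof -
    have le: "(cmod (f x))\<^sup>2 \<le> (hermite_majorant 1 x)\<^sup>2" for x
    proof -
      have t: "sqrt 2 * t \<le> 1 + sqrt 2 * \<bar>t\<bar>" for t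
      proof -
        have "sqrt 2 * t \<le> sqrt 2 * \<bar>t\<bar>"
          by (intro mult_left_mono) auto
        then show ?thesis
          by linarith
      qed
      have "cmod (f x) \<le> hermite_majorant 1 x"
        unfolding f_eq norm_of_real hermite_majorant_def hermite_majorant1_def abs_prod
        by (intro prod_mono) (auto simp: t)
      then show ?thesis
        by (intro power_mono) auto
    qed
    have "(\<integral>\<^sup>+x. ennreal (norm ((cmod (f x))\<^sup>2)) \<partial>lebesgue) \<le> (\<integral>\<^sup>+x. ennreal ((hermite_majorant 1 (x :: real ^ 'n))\<^sup>2) \<partial>lebesgue)"
      using le by (intro nn_integral_mono ennreal_leI) simp
    also have "\<dots> < \<infinity>"
      by (rule nn_integral_hermite_majorant_square) simp
    finally have "integrable lebesgue (\<lambda>x. (cmod (f x))\<^sup>2)"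
      using f_meas by (intro integrableI_bounded) auto
    with f_meas show ?thesis
      by (simp add: L2_space_def)
  qed
  moreover have "hermite_series c f"
    by (rule hermite_seriesI[OF c]) (auto simp: f_def)
  ultimately have "f \<in> H_flat1"
    unfolding H_flat1_def using c zero_less_one by blast
  then have "f \<in> H0_flat1"
    using eq by simp
  then obtain c' where ser: "hermite_series c' f"
    and "\<forall>r>0. \<exists>C. \<forall>\<alpha>. cmod (c' \<alpha>) \<le> C * (r ^ mi_abs \<alpha> * mi_fact \<alpha> powr (-1/2))"
    unfolding H0_flat1_def by blast
  then obtain C where c': "\<And>\<alpha>. cmod (c' \<alpha>) \<le> C * ((1/4) ^ mi_abs \<alpha> * mi_fact \<alpha> powr (- 1 / 2))"
    by (metis zero_less_divide_1_iff zero_less_numeral)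
  define T where "T = C * infsum (\<lambda>\<alpha>. (1 / 4 / (1 / 2)) ^ mi_abs \<alpha>) (UNIV :: ('n \<Rightarrow> nat) set)"
  have quarter: "0 < (1 / 4 :: real)"
    by simp
  have majorised: "AE x in lebesgue. cmod (f x) \<le> T * hermite_majorant (1 / 2) x"
    using hermite_series_AE_eq[OF c' quarter ser f_meas]
  proof eventually_elim
    case (elim x)
    then show ?case
      using hermite_series_estimates(2)[OF c' quarter, of "1 / 2" "{}" x] by (simp add: T_def)
  qed
  define S where "S = {x :: real ^ 'n. \<forall>i. 2 * \<bar>T\<bar> + 2 < x $ i}"
  have S: "\<not> negligible S"
  proof (rule open_not_negligible)
    have "S = (\<Inter>i. {x. 2 * \<bar>T\<bar> + 2 < x $ i})"
      by (auto simp: S_def)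
    also have "open \<dots>"
      by (intro open_INT ballI open_Collect_less continuous_intros) auto
    finally show "open S" .
    have "(\<chi> i. 2 * \<bar>T\<bar> + 3) \<in> S"
      by (simp add: S_def)
    then show "S \<noteq> {}"
      by blast
  qed
  have "\<exists>x\<in>S. cmod (f x) \<le> T * hermite_majorant (1 / 2) x"
  proof (rule ccontr)
    assume none: "\<not> ?thesis"
    from majorised have "AE x in lebesgue. x \<notin> S"
      by eventually_elim (use none in blast)
    then have "S \<in> null_sets lebesgue"
      by (simp add: completion.AE_iff_null_sets)
    with S show False
      by (simp add: negligible_iff_null_sets)
  qed
  then obtain x where x: "x \<in> S" and le: "cmod (f x) \<le> T * hermite_majorant (1 / 2) x"
    by blast
  \<comment> \<open>The ratio of \<open>f\<close> to the majorant is the product of these factors.\<close>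
  define e where "e i = exp (sqrt 2 / 2 * x $ i - 5 / 8)" for i
  have e: "1 + \<bar>T\<bar> \<le> e i" for i
  proof -
    have xi: "2 * \<bar>T\<bar> + 2 < x $ i"
      using x by (simp add: S_def)
    have "1 / 2 * x $ i \<le> sqrt 2 / 2 * x $ i"
      using xi by (intro mult_right_mono) auto
    with xi have "\<bar>T\<bar> \<le> sqrt 2 / 2 * x $ i - 5 / 8"
      by linarith
    then show ?thesis
      unfolding e_def using exp_ge_add_one_self[of "sqrt 2 / 2 * x $ i - 5 / 8"] by linarith
  qed
  have "cmod (f x) = (\<Prod>i\<in>UNIV. e i * hermite_majorant1 (1 / 2) (x $ i))"
  proof -
    have "pi powr (- 1 / 4) * exp (- (x $ i)\<^sup>2 / 2 + sqrt 2 * x $ i - 1 / 2) = e i * hermite_majorant1 (1 / 2) (x $ i)" for i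
    proof -
      have "x $ i > 0"
        using x by (auto simp: S_def intro: le_less_trans[rotated])
      then have "- (x $ i)\<^sup>2 / 2 + sqrt 2 * x $ i - 1 / 2 = (sqrt 2 / 2 * x $ i - 5 / 8)
          + (- (x $ i)\<^sup>2 / 2 + sqrt 2 * (1 / 2) * \<bar>x $ i\<bar> + (1 / 2)\<^sup>2 / 2)"
        by (simp add: power2_eq_square field_simps)
      then show ?thesis
        by (simp only: e_def hermite_majorant1_def exp_add mult_ac)
    qed
    moreover have "(\<Prod>i\<in>UNIV. e i * hermite_majorant1 (1 / 2) (x $ i)) \<ge> 0"
      by (intro prod_nonneg) (simp add: e_def hermite_majorant1_def)
    ultimately show ?thesis
      unfolding f_eq norm_of_real by simp
  qed
  then have "(\<Prod>i\<in>UNIV. e i) * hermite_majorant (1 / 2) x \<le> T * hermite_majorant (1 / 2) x"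
    using le by (simp add: prod.distrib hermite_majorant_def)
  then have "(\<Prod>i\<in>UNIV. e i) \<le> T"
    using hermite_majorant_pos[of "1 / 2" x] by simp
  moreover have "1 + \<bar>T\<bar> \<le> (1 + \<bar>T\<bar>) ^ CARD('n)"
    by (intro self_le_power) auto
  moreover have "(1 + \<bar>T\<bar>) ^ CARD('n) \<le> (\<Prod>i\<in>UNIV. e i)"
    using prod_mono[of "UNIV :: 'n set" "\<lambda>_. 1 + \<bar>T\<bar>" e] e by simp
  ultimately show False
    by linarith
qed

theorem theorem4p10:
  fixes R0 R :: real
  assumes "0 < R0" and "R0 < R"
  shows "(Omega0 R :: (complex ^ 'n::finite \<Rightarrow> complex) set) \<subseteq> Omega2 R \<and>
    (Omega2 R0 :: (complex ^ 'n \<Rightarrow> complex) set) \<subseteq> Omega1 R \<and>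
    (S_C :: (real ^ 'n \<Rightarrow> complex) set) = H_flat1 \<and>
    (H0_flat1 :: (real ^ 'n \<Rightarrow> complex) set) \<subset> S_C"
  using assms Omega0_subset_Omega2[of R] Omega2_subset_Omega1[OF assms] S_C_subset_H_flat1 H_flat1_subset_S_C
    H0_flat1_subset_H_flat1 H0_flat1_neq_H_flat1
  by (auto simp: psubset_eq)

end
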